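(* Let $n\ge 2$ and let $r/s$ be an irreducible fraction with $s>0$. If $\Phi_n(q)$ divides $\mathcal{S}_{r/s}(q)$, then $[n]_q$ divides $\mathcal{S}_{r/s}(q)$, and moreover $s\equiv 0$ and $r\equiv\pm1\pmod n$. If $\Phi_n(q)$ divides $\mathcal{R}_{r/s}(q)$, then $[n]_q$ divides $\mathcal{R}_{r/s}(q)$, and moreover $r\equiv 0$ and $s\equiv\pm1\pmod n$.
   Context: $q$-deformed rationals: every irreducible fraction $r/s>1$ has a unique Hirzebruch--Jung expansion $r/s=[\![c_1,\dots,c_k]\!]=c_1-\cfrac{1}{c_2-\cfrac{1}{\ddots-\cfrac{1}{c_k}}}$ with all $c_i\ge 2$ integers. Put $R_q=\begin{pmatrix}q&1\\0&1\end{pmatrix}$, $S_q=\begin{pmatrix}0&-q^{-1}\\1&0\end{pmatrix}$ and $M_q(c_1,\dots,c_k)=R_q^{c_1}S_q\cdots R_q^{c_k}S_q$. For $r/s=[\![c_1,\dots,c_k]\!]>1$, the polynomials $\mathcal{R}_{r/s}(q),\mathcal{S}_{r/s}(q)\in\mathbb{Z}[q]$ are the upper and lower entries of the first column of $M_q(c_1,\dots,c_k)$, and $[r/s]_q=\mathcal{R}_{r/s}(q)/\mathcal{S}_{r/s}(q)$. This is extended to $\mathbb{Q}\cup\{\infty\}$ by $[\alpha+1]_q=q[\alpha]_q+1$, $[0/1]_q=0$, $[1/0]_q=1/0$. For an arbitrary irreducible fraction $r/s$ with $s>0$, $\mathcal{R}_{r/s}(q)$ and $\mathcal{S}_{r/s}(q)$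 are the coprime Laurent polynomials with integer coefficients such that $[r/s]_q=\mathcal{R}_{r/s}(q)/\mathcal{S}_{r/s}(q)$, $\mathcal{S}_{r/s}(q)\in\mathbb{Z}[q]$ and $\mathcal{S}_{r/s}(0)=1$. Divisibility of Laurent polynomials is in $\mathbb{Z}[q^{\pm1}]$. $\Phi_n(q)$ is the $n$-th cyclotomic polynomial and, for $n\ge 1$, $[n]_q=1+q+\dots+q^{n-1}$. *)

theory Defs
  imports
    "HOL-Library.Poly_Mapping"
    "HOL-Computational_Algebra.Computational_Algebra"
    "HOL-Number_Theory.Totient"
    "Jordan_Normal_Form.Char_Poly"
begin

section \<open>Laurent polynomials\<close>

text \<open>The Laurent polynomial ring is the group ring of the integers: the element
  \<open>f\<close> is the finite sum of the \<open>lookup f k * q^k\<close>, and \<open>*\<close> is convolution. The library's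
  \<open>dvd\<close> on this type is therefore divisibility of Laurent polynomials.\<close>

type_synonym laurent = "int \<Rightarrow>\<^sub>0 int"

definition q :: laurent where
  "q = Poly_Mapping.single 1 1"

definition q_inv :: laurent where
  "q_inv = Poly_Mapping.single (-1) 1"

definition of_poly :: "int poly \<Rightarrow> laurent" where
  "of_poly p = poly (map_poly of_int p) q"

definition q_int :: "nat \<Rightarrow> laurent" where
  "q_int n = (\<Sum>i<n. q ^ i)"

definition complex_cyclotomic :: "nat \<Rightarrow> complex poly" where
  "complex_cyclotomic n = (\<Prod>k\<in>totatives n. [:- cis (2 * pi * real k / real n), 1:])"

definition cyclotomic :: "nat \<Rightarrow> int poly" where
  "cyclotomic n = (THE p. map_poly of_int p = complex_cyclotomic n)"


section \<open>Hirzebruch--Jung continued fractions and the deformed rationals\<close>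

fun hj_eval :: "nat list \<Rightarrow> rat" where
  "hj_eval [] = 0"
| "hj_eval [c] = of_nat c"
| "hj_eval (c # d # cs) = of_nat c - 1 / hj_eval (d # cs)"

definition is_hj_expansion :: "rat \<Rightarrow> nat list \<Rightarrow> bool" where
  "is_hj_expansion x cs \<longleftrightarrow> cs \<noteq> [] \<and> (\<forall>c\<in>set cs. 2 \<le> c) \<and> hj_eval cs = x"

definition hj_expansion :: "rat \<Rightarrow> nat list" where
  "hj_expansion x = (THE cs. is_hj_expansion x cs)"

definition R_mat :: "laurent mat" where
  "R_mat = mat_of_rows_list 2 [[q, 1], [0, 1]]"

definition S_mat :: "laurent mat" where
  "S_mat = mat_of_rows_list 2 [[0, - q_inv], [1, 0]]"

fun M_mat :: "nat list \<Rightarrow> laurent mat" where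
  "M_mat [] = 1\<^sub>m 2"
| "M_mat (c # cs) = R_mat ^\<^sub>m c * S_mat * M_mat cs"

text \<open>For \<open>x > 1\<close> the value is read off the matrix; elsewhere it is determined by the rule
  \<open>[x + 1] = q * [x] + 1\<close>, solved for \<open>[x]\<close>. The rule itself, for all \<open>x\<close>, and \<open>[0] = 0\<close> are
  proved below. The point \<open>1/0\<close> at infinity is left out.\<close>

function q_rat :: "rat \<Rightarrow> laurent fract" where
  "q_rat x =
     (if x > 1
      then Fraction_Field.Fract (M_mat (hj_expansion x) $$ (0, 0)) (M_mat (hj_expansion x) $$ (1, 0))
      else (q_rat (x + 1) - 1) / Fraction_Field.Fract q 1)"
  by auto
termination
  by (relation "measure (\<lambda>x. nat (2 - \<lfloor>x\<rfloor>))") (auto simp: floor_less_iff not_less le_less)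

declare q_rat.simps [simp del]

text \<open>The second conjunct says that \<open>R\<close> and \<open>S\<close> are coprime; the library's \<open>coprime\<close> is not
  available on this type, whose elements have no division operation.\<close>

definition is_q_fraction :: "rat \<Rightarrow> laurent \<Rightarrow> laurent \<Rightarrow> bool" where
  "is_q_fraction x R S \<longleftrightarrow>
     q_rat x = Fraction_Field.Fract R S \<and>
     (\<forall>d. d dvd R \<longrightarrow> d dvd S \<longrightarrow> d dvd 1) \<and>
     (\<forall>k<0. Poly_Mapping.lookup S k = 0) \<and> Poly_Mapping.lookup S 0 = 1"

definition q_numer :: "rat \<Rightarrow> laurent" where
  "q_numer x = (THE R. \<exists>S. is_q_fraction x R S)"

definition q_denom :: "rat \<Rightarrow> laurent" where
  "q_denom x = (THE S. \<exists>R. is_q_fraction x R S)"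


section \<open>Existence and uniqueness of the objects defined by description\<close>

subsection \<open>Hirzebruch--Jung expansions\<close>

lemma hj_eval_Cons: "hj_eval (c # cs) = of_nat c - 1 / hj_eval cs"
  by (cases cs) auto

lemma hj_eval_gt_1: "cs \<noteq> [] \<Longrightarrow> \<forall>c\<in>set cs. 2 \<le> c \<Longrightarrow> hj_eval cs > 1"
proof (induction cs)
  case (Cons c cs)
  have c: "(of_nat c :: rat) \<ge> 2"
    using Cons.prems by (metis list.set_intros(1) of_nat_le_iff of_nat_numeral)
  show ?case
  proof (cases "cs = []")
    case False
    then have "hj_eval cs > 1" using Cons by auto
    then have "1 / hj_eval cs < 1" by simp
    then show ?thesis using c by (simp add: hj_eval_Cons)
  qed (use c in auto)
qed simp

lemma ceiling_hj_eval:
  assumes "\<forall>c\<in>set (c # cs). 2 \<le> c"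
  shows "\<lceil>hj_eval (c # cs)\<rceil> = int c"
proof (cases "cs = []")
  case False
  then have "hj_eval cs > 1" using assms hj_eval_gt_1 by auto
  then have "0 < 1 / hj_eval cs" "1 / hj_eval cs < 1" by auto
  then show ?thesis by (auto simp: hj_eval_Cons ceiling_eq_iff)
qed simp

lemma hj_expansion_unique:
  "is_hj_expansion x cs \<Longrightarrow> is_hj_expansion x ds \<Longrightarrow> cs = ds"
proof (induction cs arbitrary: x ds)
  case (Cons c cs)
  from Cons.prems obtain d ds' where ds: "ds = d # ds'"
    by (cases ds) (auto simp: is_hj_expansion_def)
  have "int c = int d"
    using Cons.prems ceiling_hj_eval[of c cs] ceiling_hj_eval[of d ds']
    unfolding is_hj_expansion_def ds by metis
  then have cd: "c = d" by simp
  have eq: "1 / hj_eval cs = 1 / hj_eval ds'"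
    using Cons.prems by (auto simp: is_hj_expansion_def ds cd hj_eval_Cons)
  have pos: "es \<noteq> [] \<longleftrightarrow> hj_eval es \<noteq> 0" if "\<forall>c\<in>set es. 2 \<le> c" for es
    using hj_eval_gt_1[of es] that by (cases "es = []") auto
  have all: "\<forall>c\<in>set cs. 2 \<le> c" "\<forall>c\<in>set ds'. 2 \<le> c"
    using Cons.prems by (auto simp: is_hj_expansion_def ds)
  show ?case
  proof (cases "cs = []")
    case True
    then have "ds' = []" using eq pos all by auto
    then show ?thesis using True ds cd by simp
  next
    case False
    then have "ds' \<noteq> []" using eq pos all by auto
    then have "cs = ds'"
      using Cons.IH[of "hj_eval cs" ds'] False all eq by (auto simp: is_hj_expansion_def)
    then show ?thesis using ds cd by simp
  qed
qed (auto simp: is_hj_expansion_def)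

lemma hj_expansion_exists_aux:
  fixes a b :: int
  assumes "0 < b" "b < a"
  shows "\<exists>cs. is_hj_expansion (of_int a / of_int b) cs"
  using assms
proof (induction "nat b" arbitrary: a b rule: less_induct)
  case less
  define c where "c = \<lceil>(of_int a / of_int b :: rat)\<rceil>"
  have c1: "(of_int a / of_int b :: rat) \<le> of_int c"
    and c2: "of_int c < (of_int a / of_int b :: rat) + 1"
    unfolding c_def by linarith+
  have "(1::rat) < of_int a / of_int b" using less.prems by simp
  then have "c \<ge> 2" using c1 by linarith
  have "(of_int a :: rat) \<le> of_int (c * b)" using c1 less.prems by (simp add: field_simps)
  then have l: "a \<le> c * b" by linarith
  have "(of_int (c * b) :: rat) < of_int (a + b)" using c2 less.prems by (simp add: field_simps)
  then have u: "c * b - a < b" by linarith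
  show ?case
  proof (cases "c * b = a")
    case True
    then have "is_hj_expansion (of_int a / of_int b) [nat c]"
      using less.prems \<open>c \<ge> 2\<close> by (auto simp: is_hj_expansion_def field_simps)
    then show ?thesis by blast
  next
    case False
    then have "nat (c * b - a) < nat b" "0 < c * b - a" using l u less.prems by auto
    then obtain cs where cs: "is_hj_expansion (of_int b / of_int (c * b - a)) cs"
      using less.hyps[of "c * b - a" b] u by auto
    then have "is_hj_expansion (of_int a / of_int b) (nat c # cs)"
      using less.prems \<open>c \<ge> 2\<close> \<open>0 < c * b - a\<close>
      by (auto simp: is_hj_expansion_def hj_eval_Cons field_simps)
    then show ?thesis by blast
  qed
qed

theorem ex1_hj_expansion:
  assumes "x > 1"
  shows "\<exists>!cs. is_hj_expansion x cs"
proof -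
  obtain a b where ab: "quotient_of x = (a, b)" by (cases "quotient_of x")
  then have x: "x = of_int a / of_int b" and "b > 0"
    by (auto simp: quotient_of_div quotient_of_denom_pos)
  then have "b < a" using assms by simp
  then show ?thesis
    using hj_expansion_exists_aux[of b a] \<open>b > 0\<close> x hj_expansion_unique by blast
qed

lemma is_hj_expansion_hj_expansion: "x > 1 \<Longrightarrow> is_hj_expansion x (hj_expansion x)"
  unfolding hj_expansion_def by (rule theI') (rule ex1_hj_expansion)

lemma hj_expansion_eqI: "is_hj_expansion x cs \<Longrightarrow> hj_expansion x = cs"
  unfolding hj_expansion_def using hj_expansion_unique by blast


subsection \<open>Embedding of polynomials\<close>

lemma q_mult_q_inv [simp]: "q * q_inv = 1" "q_inv * q = 1"
  by (simp_all add: q_def q_inv_def mult_single)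

lemma q_nonzero [simp]: "q \<noteq> 0"
  using q_mult_q_inv by (metis mult_zero_left zero_neq_one)

lemma q_power: "q ^ n = Poly_Mapping.single (int n) 1"
  by (induction n) (auto simp: q_def mult_single)

lemma of_int_single: "of_int a = (Poly_Mapping.single 0 a :: laurent)"
proof -
  have "Poly_Mapping.single 0 (of_int a :: int) = (of_int a :: laurent)" by (rule single_of_int)
  then show ?thesis by (simp only: of_int_eq_id id_apply)
qed

lemma of_poly_0 [simp]: "of_poly 0 = 0"
  and of_poly_1 [simp]: "of_poly 1 = 1"
  and of_poly_add [simp]: "of_poly (p + r) = of_poly p + of_poly r"
  and of_poly_diff [simp]: "of_poly (p - r) = of_poly p - of_poly r"
  and of_poly_mult [simp]: "of_poly (p * r) = of_poly p * of_poly r"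
  and of_poly_power [simp]: "of_poly (p ^ n) = of_poly p ^ n"
  and of_poly_X [simp]: "of_poly [:0, 1:] = q"
  by (simp_all add: of_poly_def hom_distribs)

lemma lookup_of_poly: "Poly_Mapping.lookup (of_poly p) k = (if k \<ge> 0 then coeff p (nat k) else 0)"
proof -
  have "of_poly p = (\<Sum>i\<le>degree p. Poly_Mapping.single (int i) (coeff p i))"
    by (simp add: of_poly_def poly_altdef q_power of_int_single mult_single degree_map_poly coeff_map_poly)
  then have "Poly_Mapping.lookup (of_poly p) k = (\<Sum>i\<le>degree p. if int i = k then coeff p i else 0)"
    by (simp add: lookup_sum lookup_single when_def)
  also have "\<dots> = (if k \<ge> 0 then coeff p (nat k) else 0)"
  proof (cases "k \<ge> 0")
    case True
    then have "(\<Sum>i\<le>degree p. if int i = k then coeff p i else 0)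
        = (\<Sum>i\<le>degree p. if i = nat k then coeff p i else 0)"
      by (intro sum.cong) auto
    then show ?thesis using True by (auto simp: coeff_eq_0)
  qed (auto intro!: sum.neutral)
  finally show ?thesis .
qed

lemma of_poly_inject [simp]: "of_poly p = of_poly r \<longleftrightarrow> p = r"
proof
  assume "of_poly p = of_poly r"
  then have "coeff p n = coeff r n" for n
    using lookup_of_poly[of p "int n"] lookup_of_poly[of r "int n"] by simp
  then show "p = r" by (simp add: poly_eq_iff)
qed simp

lemma of_poly_surj:
  assumes "\<forall>k<0. Poly_Mapping.lookup f k = 0"
  shows "\<exists>p. f = of_poly p"
proof -
  have "finite {n. Poly_Mapping.lookup f (int n) \<noteq> 0}"
    using finite_imageD[of int "{n. Poly_Mapping.lookup f (int n) \<noteq> 0}"]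
      finite_subset[of "int ` {n. Poly_Mapping.lookup f (int n) \<noteq> 0}" "{k. Poly_Mapping.lookup f k \<noteq> 0}"]
    by (auto simp: finite_lookup)
  then have "coeff (Abs_poly (\<lambda>n. Poly_Mapping.lookup f (int n))) = (\<lambda>n. Poly_Mapping.lookup f (int n))"
    by (intro Abs_poly_inverse) (auto simp: MOST_iff_cofinite)
  then have "f = of_poly (Abs_poly (\<lambda>n. Poly_Mapping.lookup f (int n)))"
    using assms by (intro poly_mapping_eqI) (auto simp: lookup_of_poly)
  then show ?thesis by blast
qed

lemma laurent_times_q_power:
  fixes f :: laurent
  shows "\<exists>n p. q ^ n * f = of_poly p"
proof (induction f rule: update_induct)
  case const
  have "q ^ 0 * 0 = of_poly 0" by simp
  then show ?case by blast
next
  case (update f k v)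
  let ?g = "Poly_Mapping.single k v"
  have "q ^ nat \<bar>k\<bar> * ?g = Poly_Mapping.single (\<bar>k\<bar> + k) v"
    by (simp add: q_power mult_single)
  moreover have "\<forall>j<0. Poly_Mapping.lookup (Poly_Mapping.single (\<bar>k\<bar> + k) v) j = 0"
    by (auto simp: lookup_single when_def)
  ultimately have "\<exists>m r. q ^ m * ?g = of_poly r" using of_poly_surj by metis
  then obtain n p m r where 1: "q ^ n * f = of_poly p" "q ^ m * ?g = of_poly r"
    using update.IH by blast
  have "q ^ (n + m) * (f + ?g) = q ^ m * (q ^ n * f) + q ^ n * (q ^ m * ?g)"
    by (simp add: algebra_simps power_add)
  also have "\<dots> = of_poly ([:0, 1:] ^ m * p + [:0, 1:] ^ n * r)"
    by (simp add: 1)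
  finally have "q ^ (n + m) * (f + ?g) = of_poly ([:0, 1:] ^ m * p + [:0, 1:] ^ n * r)" .
  moreover have "Poly_Mapping.update k v f = f + ?g"
    using update.hyps
    by (intro poly_mapping_eqI) (auto simp: lookup_update lookup_add lookup_single when_def in_keys_iff)
  ultimately show ?case by metis
qed


subsection \<open>Numerators and denominators\<close>

lemma mult_mat_2:
  assumes "A \<in> carrier_mat 2 2" "B \<in> carrier_mat 2 2" "i < 2" "j < 2"
  shows "(A * B) $$ (i, j) = A $$ (i, 0) * B $$ (0, j) + A $$ (i, 1) * B $$ (1, j)"
  using assms by (auto simp: scalar_prod_def numeral_2_eq_2)

lemma R_mat_carrier [simp]: "R_mat \<in> carrier_mat 2 2"
  and S_mat_carrier [simp]: "S_mat \<in> carrier_mat 2 2"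
  by (auto simp: R_mat_def S_mat_def mat_of_rows_list_def)

lemma R_mat_power_carrier [simp]: "R_mat ^\<^sub>m c \<in> carrier_mat 2 2"
  by (rule pow_carrier_mat) simp

lemma M_mat_carrier [simp]: "M_mat cs \<in> carrier_mat 2 2"
  by (induction cs) (auto intro!: mult_carrier_mat[of _ 2 2])

lemma R_mat_index: "R_mat $$ (0, 0) = q" "R_mat $$ (0, 1) = 1" "R_mat $$ (1, 0) = 0" "R_mat $$ (1, 1) = 1"
  by (auto simp: R_mat_def mat_of_rows_list_def)

lemma S_mat_index: "S_mat $$ (0, 0) = 0" "S_mat $$ (0, 1) = - q_inv" "S_mat $$ (1, 0) = 1" "S_mat $$ (1, 1) = 0"
  by (auto simp: S_mat_def mat_of_rows_list_def)

lemma R_mat_power_index: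
  "(R_mat ^\<^sub>m c) $$ (0, 0) = q ^ c \<and> (R_mat ^\<^sub>m c) $$ (0, 1) = q_int c \<and>
   (R_mat ^\<^sub>m c) $$ (1, 0) = 0 \<and> (R_mat ^\<^sub>m c) $$ (1, 1) = 1"
proof (induction c)
  case 0
  have "dim_row R_mat = 2" using R_mat_carrier by blast
  then show ?case by (simp add: q_int_def)
next
  case (Suc c)
  then show ?case
    by (auto simp: mult_mat_2 R_mat_index q_int_def simp del: One_nat_def)
qed

lemma M_mat_Cons_index:
  "M_mat (c # cs) $$ (0, 0) = q_int c * M_mat cs $$ (0, 0) - q ^ c * q_inv * M_mat cs $$ (1, 0)"
  "M_mat (c # cs) $$ (1, 0) = M_mat cs $$ (0, 0)"
proof -
  have RS: "R_mat ^\<^sub>m c * S_mat \<in> carrier_mat 2 2"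
    by (intro mult_carrier_mat[of _ 2 2]) auto
  have e: "(R_mat ^\<^sub>m c * S_mat) $$ (0, 0) = q_int c" "(R_mat ^\<^sub>m c * S_mat) $$ (0, 1) = - (q ^ c * q_inv)"
    "(R_mat ^\<^sub>m c * S_mat) $$ (1, 0) = 1" "(R_mat ^\<^sub>m c * S_mat) $$ (1, 1) = 0"
    by (simp_all add: mult_mat_2 R_mat_power_index S_mat_index del: One_nat_def)
  show "M_mat (c # cs) $$ (0, 0) = q_int c * M_mat cs $$ (0, 0) - q ^ c * q_inv * M_mat cs $$ (1, 0)"
    "M_mat (c # cs) $$ (1, 0) = M_mat cs $$ (0, 0)"
    unfolding M_mat.simps
    by (simp_all add: mult_mat_2[OF RS M_mat_carrier] e del: One_nat_def)
qed

lemma M_mat_bezout: "\<exists>u v. u * M_mat cs $$ (0, 0) + v * M_mat cs $$ (1, 0) = 1"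
proof (induction cs)
  case Nil
  show ?case by (rule exI[of _ 1], rule exI[of _ 0]) simp
next
  case (Cons c cs)
  then obtain u v where uv: "u * M_mat cs $$ (0, 0) + v * M_mat cs $$ (1, 0) = 1" by blast
  let ?A = "M_mat cs $$ (0, 0)" and ?B = "M_mat cs $$ (1, 0)"
  have inv: "q_inv ^ c * q ^ c = 1" by (simp flip: power_mult_distrib)
  have "q_inv ^ c * q * (q ^ c * q_inv * ?B) = (q_inv ^ c * q ^ c) * (q * q_inv) * ?B"
    by (simp only: ac_simps)
  then have B: "q_inv ^ c * q * (q ^ c * q_inv * ?B) = ?B" by (simp add: inv)
  have "(- v * (q_inv ^ c * q)) * (q_int c * ?A - q ^ c * q_inv * ?B)
      + (u + v * (q_inv ^ c * q) * q_int c) * ?A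
      = u * ?A + v * (q_inv ^ c * q * (q ^ c * q_inv * ?B))"
    by (simp add: algebra_simps)
  also have "\<dots> = 1" by (simp only: B uv)
  finally show ?case unfolding M_mat_Cons_index by blast
qed

lemma M_mat_poly:
  assumes "\<forall>c\<in>set cs. 2 \<le> c"
  shows "\<exists>a b. M_mat cs $$ (0, 0) = of_poly a \<and> M_mat cs $$ (1, 0) = of_poly b \<and>
     coeff a 0 = 1 \<and> (cs \<noteq> [] \<longrightarrow> coeff b 0 = 1)"
  using assms
proof (induction cs)
  case Nil
  show ?case by (rule exI[of _ 1], rule exI[of _ 0]) simp
next
  case (Cons c cs)
  then obtain a b where ab: "M_mat cs $$ (0, 0) = of_poly a" "M_mat cs $$ (1, 0) = of_poly b" "coeff a 0 = 1"
    by auto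
  obtain d where d: "c = Suc (Suc d)" using Cons.prems by (metis Suc_le_D list.set_intros(1) numeral_2_eq_2 Suc_le_mono)
  have "of_poly (\<Sum>i<n. [:0, 1:] ^ i) = q_int n" for n
    by (induction n) (auto simp: q_int_def)
  note qi = this
  have "q ^ c * q_inv = q ^ Suc d * (q * q_inv)" by (simp only: d power_Suc ac_simps)
  then have qc: "q ^ c * q_inv = of_poly ([:0, 1:] ^ Suc d)" by (simp only: of_poly_power of_poly_X q_mult_q_inv mult_1_right)
  have "coeff (\<Sum>i<c. [:0, 1:] ^ i :: int poly) 0 = (\<Sum>i<c. 0 ^ i)"
    by (simp add: poly_sum poly_power flip: poly_0_coeff_0)
  also have "\<dots> = 1" by (simp add: d sum.lessThan_Suc_shift del: sum.lessThan_Suc)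
  finally have "coeff (\<Sum>i<c. [:0, 1:] ^ i :: int poly) 0 = 1" .
  then have "coeff ((\<Sum>i<c. [:0, 1:] ^ i) * a - [:0, 1:] ^ Suc d * b) 0 = 1"
    using ab(3) by (simp add: coeff_mult)
  moreover have "M_mat (c # cs) $$ (0, 0) = of_poly ((\<Sum>i<c. [:0, 1:] ^ i) * a - [:0, 1:] ^ Suc d * b)"
    unfolding M_mat_Cons_index by (simp only: of_poly_diff of_poly_mult qi qc ab)
  moreover have "M_mat (c # cs) $$ (1, 0) = of_poly a"
    unfolding M_mat_Cons_index by (rule ab)
  ultimately show ?case using ab(3) by blast
qed

lemma is_q_fraction_of_bezout:
  assumes "q_rat x = Fraction_Field.Fract R S" "u * R + v * S = 1" "S = of_poly s" "coeff s 0 = 1"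
  shows "is_q_fraction x R S"
  unfolding is_q_fraction_def
proof (intro conjI allI impI)
  fix d assume "d dvd R" "d dvd S"
  then have "d dvd u * R + v * S" by simp
  then show "d dvd 1" using assms by simp
qed (use assms in \<open>auto simp: lookup_of_poly\<close>)

lemma q_rat_bezout:
  "\<exists>R S u v s. q_rat x = Fraction_Field.Fract R S \<and> u * R + v * S = 1 \<and> S = of_poly s \<and> coeff s 0 = 1"
proof (induction x rule: q_rat.induct)
  case (1 x)
  show ?case
  proof (cases "x > 1")
    case True
    have hj: "is_hj_expansion x (hj_expansion x)" using True by (rule is_hj_expansion_hj_expansion)
    then show ?thesis
      using M_mat_poly[of "hj_expansion x"] M_mat_bezout[of "hj_expansion x"] True
      unfolding q_rat.simps[of x] is_hj_expansion_def by auto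
  next
    case False
    then obtain R S u v s where IH: "q_rat (x + 1) = Fraction_Field.Fract R S" "u * R + v * S = 1"
      "S = of_poly s" "coeff s 0 = 1"
      using "1.IH" by blast
    have "S \<noteq> 0" using IH(3,4) lookup_of_poly[of s 0] by auto
    have "q_rat x = (Fraction_Field.Fract R S - 1) / Fraction_Field.Fract q 1"
      using False by (simp add: q_rat.simps[of x] IH)
    also have "\<dots> = Fraction_Field.Fract (R - S) (S * q)"
      using \<open>S \<noteq> 0\<close> by (simp add: Fraction_Field.One_fract_def)
    also have "\<dots> = Fraction_Field.Fract (q_inv * (R - S)) S"
    proof -
      have "(R - S) * S = q_inv * q * ((R - S) * S)" by simp
      also have "\<dots> = q_inv * (R - S) * (S * q)" by (simp only: ac_simps)
      finally show ?thesis using \<open>S \<noteq> 0\<close> by (simp add: Fraction_Field.eq_fract)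
    qed
    finally have "q_rat x = Fraction_Field.Fract (q_inv * (R - S)) S" .
    moreover have "(u * q) * (q_inv * (R - S)) + (v + u) * S = 1"
    proof -
      have "(u * q) * (q_inv * (R - S)) = (q * q_inv) * (u * (R - S))" by (simp only: ac_simps)
      then have "(u * q) * (q_inv * (R - S)) = u * (R - S)" by (simp only: q_mult_q_inv mult_1_left)
      then show ?thesis using IH(2) by (simp only: right_diff_distrib distrib_right) simp
    qed
    ultimately show ?thesis using IH by blast
  qed
qed

lemma poly_factor_of_shift:
  fixes s t p :: "int poly"
  assumes "[:0, 1:] ^ n * t = s * p" "coeff s 0 = 1"
  shows "\<exists>p'. p = [:0, 1:] ^ n * p' \<and> t = s * p'"
  using assms
proof (induction n arbitrary: p)
  case (Suc n)
  have "poly s 0 * poly p 0 = poly ([:0, 1:] ^ Suc n * t) 0"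
    by (simp only: Suc.prems(1) poly_mult)
  then have "poly p 0 = 0" using Suc.prems(2) by (simp add: poly_0_coeff_0)
  then obtain p1 where p1: "p = [:0, 1:] * p1" by (metis dvd_def poly_eq_0_iff_dvd minus_zero)
  have "[:0, 1:] * ([:0, 1:] ^ n * t) = [:0, 1:] * (s * p1)"
    using Suc.prems(1) by (simp only: p1 power_Suc ac_simps)
  then have "[:0, 1:] ^ n * t = s * p1" using mult_left_cancel[of "[:0, 1:] :: int poly"] by (metis pCons_eq_0_iff zero_neq_one)
  then obtain p' where "p1 = [:0, 1:] ^ n * p'" "t = s * p'" using Suc by blast
  then show ?case using p1 by (auto simp only: power_Suc mult.assoc)
qed auto

lemma of_poly_dvd_of_poly:
  assumes "of_poly t = of_poly s * f" "coeff s 0 = 1"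
  shows "\<exists>r. f = of_poly r \<and> t = s * r"
proof -
  obtain n p where np: "q ^ n * f = of_poly p" using laurent_times_q_power by blast
  have "of_poly ([:0, 1:] ^ n * t) = of_poly s * (q ^ n * f)"
    by (simp add: assms(1) ac_simps)
  then have "of_poly ([:0, 1:] ^ n * t) = of_poly (s * p)" by (simp add: np)
  then have "[:0, 1:] ^ n * t = s * p" by (simp only: of_poly_inject)
  then obtain r where r: "p = [:0, 1:] ^ n * r" "t = s * r"
    using poly_factor_of_shift assms(2) by blast
  then have "q ^ n * f = q ^ n * of_poly r" using np by simp
  then show ?thesis using r(2) by auto
qed

lemma is_q_fraction_unique:
  assumes bez: "q_rat x = Fraction_Field.Fract R S" "u * R + v * S = 1" "S = of_poly s" "coeff s 0 = 1"
    and frac: "is_q_fraction x R' S'"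
  shows "R' = R \<and> S' = S"
proof -
  have "S \<noteq> 0" using bez(3,4) lookup_of_poly[of s 0] by auto
  have "S' \<noteq> 0" using frac by (auto simp: is_q_fraction_def)
  obtain s' where s': "S' = of_poly s'" using frac of_poly_surj[of S'] by (auto simp: is_q_fraction_def)
  then have s'0: "coeff s' 0 = 1" using frac lookup_of_poly[of s' 0] by (auto simp: is_q_fraction_def)
  have cross: "R' * S = R * S'"
    using bez(1) frac \<open>S \<noteq> 0\<close> \<open>S' \<noteq> 0\<close> by (simp add: is_q_fraction_def Fraction_Field.eq_fract)
  define f where "f = u * R' + v * S'"
  have "S * f = u * (R' * S) + v * S' * S" by (simp add: f_def algebra_simps)
  also have "\<dots> = S' * (u * R + v * S)" by (simp add: cross algebra_simps)
  finally have S': "S' = S * f" by (simp only: bez(2) mult_1_right)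
  have "R' * S = R * f * S" using cross S' by (simp add: ac_simps)
  then have R': "R' = R * f" using \<open>S \<noteq> 0\<close> by simp
  have "f dvd 1" using frac S' R' by (auto simp: is_q_fraction_def)
  then obtain g where fg: "f * g = 1" by (metis dvdE)
  obtain r where r: "f = of_poly r" "s' = s * r"
    using of_poly_dvd_of_poly[of s' s f] S' s' bez by auto
  have "S = S' * g" using S' fg by (simp add: mult.assoc)
  then obtain r' where r': "g = of_poly r'" using of_poly_dvd_of_poly[of s s' g] s' bez s'0 by auto
  have "of_poly (r * r') = of_poly 1" using fg r(1) r' by simp
  then have "r * r' = 1" by (simp only: of_poly_inject)
  then have "is_unit r" by (metis dvd_def)
  then obtain c where "r = [:c:]" by (auto simp: is_unit_poly_iff)
  moreover have "coeff r 0 = 1" using r(2) s'0 bez(4) by (simp add: coeff_mult)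
  ultimately have "r = 1" by (simp add: one_pCons)
  then show ?thesis using r(1) S' R' by simp
qed

theorem ex1_q_fraction: "\<exists>!(R, S). is_q_fraction x R S"
proof -
  obtain R S u v s where b: "q_rat x = Fraction_Field.Fract R S" "u * R + v * S = 1"
    "S = of_poly s" "coeff s 0 = 1"
    using q_rat_bezout by blast
  show ?thesis
  proof (rule ex1I[of _ "(R, S)"])
    show "case (R, S) of (R, S) \<Rightarrow> is_q_fraction x R S"
      using is_q_fraction_of_bezout[OF b] by simp
    show "y = (R, S)" if "case y of (R, S) \<Rightarrow> is_q_fraction x R S" for y
      using that is_q_fraction_unique[OF b] by (cases y) auto
  qed
qed

lemma is_q_fraction_iff: "is_q_fraction x R S \<longleftrightarrow> R = q_numer x \<and> S = q_denom x"
proof -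
  obtain R0 S0 where 0: "is_q_fraction x R0 S0"
    and uniq: "\<And>R S. is_q_fraction x R S \<Longrightarrow> R = R0 \<and> S = S0"
    using ex1_q_fraction[of x] by blast
  have "q_numer x = R0" "q_denom x = S0"
    unfolding q_numer_def q_denom_def using 0 uniq by blast+
  then show ?thesis using 0 uniq by blast
qed

text \<open>For \<open>x > 1\<close> these are the entries of the first column of the matrix.\<close>

theorem q_numer_denom_eq_M_mat:
  assumes "x > 1"
  shows "q_numer x = M_mat (hj_expansion x) $$ (0, 0)"
    and "q_denom x = M_mat (hj_expansion x) $$ (1, 0)"
proof -
  let ?M = "M_mat (hj_expansion x)"
  have hj: "is_hj_expansion x (hj_expansion x)" using assms by (rule is_hj_expansion_hj_expansion)
  obtain b where "?M $$ (1, 0) = of_poly b" "coeff b 0 = 1"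
    using M_mat_poly[of "hj_expansion x"] hj by (auto simp: is_hj_expansion_def)
  moreover obtain u v where "u * ?M $$ (0, 0) + v * ?M $$ (1, 0) = 1"
    using M_mat_bezout by blast
  moreover have "q_rat x = Fraction_Field.Fract (?M $$ (0, 0)) (?M $$ (1, 0))"
    using assms by (simp add: q_rat.simps[of x])
  ultimately have "is_q_fraction x (?M $$ (0, 0)) (?M $$ (1, 0))"
    using is_q_fraction_of_bezout by blast
  then show "q_numer x = ?M $$ (0, 0)" "q_denom x = ?M $$ (1, 0)"
    by (simp_all add: is_q_fraction_iff)
qed


subsection \<open>The shift rule\<close>

theorem q_rat_add_1: "q_rat (x + 1) = Fraction_Field.Fract q 1 * q_rat x + 1"
proof (cases "x > 1")
  case False
  have "Fraction_Field.Fract q 1 \<noteq> 0" by (simp add: Fraction_Field.Zero_fract_def Fraction_Field.eq_fract)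
  then show ?thesis using False by (simp add: q_rat.simps[of x])
next
  case True
  define cs where "cs = hj_expansion x"
  have hj: "is_hj_expansion x cs" unfolding cs_def using True by (rule is_hj_expansion_hj_expansion)
  then obtain c ds where cs: "cs = c # ds" by (cases cs) (auto simp: is_hj_expansion_def)
  have "is_hj_expansion (x + 1) (Suc c # ds)"
    using hj by (auto simp: cs is_hj_expansion_def hj_eval_Cons)
  then have 1: "hj_expansion (x + 1) = Suc c # ds" by (rule hj_expansion_eqI)
  have n: "M_mat (Suc c # ds) $$ (0, 0) = q * M_mat cs $$ (0, 0) + M_mat cs $$ (1, 0)"
  proof -
    have "q_int (Suc c) = q * q_int c + 1"
      unfolding q_int_def by (subst sum.lessThan_Suc_shift) (simp add: sum_distrib_left)
    then show ?thesis unfolding cs M_mat_Cons_index by (simp add: algebra_simps)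
  qed
  have d: "M_mat (Suc c # ds) $$ (1, 0) = M_mat cs $$ (1, 0)"
    unfolding cs M_mat_Cons_index ..
  obtain b where "M_mat cs $$ (1, 0) = of_poly b" "coeff b 0 = 1"
    using M_mat_poly[of cs] hj by (auto simp: is_hj_expansion_def)
  then have nz: "M_mat cs $$ (1, 0) \<noteq> 0" using lookup_of_poly[of b 0] by auto
  show ?thesis
    using True nz
    by (simp add: q_rat.simps[of x] q_rat.simps[of "x + 1"] 1 n d Fraction_Field.One_fract_def
        Fraction_Field.eq_fract flip: cs_def del: M_mat.simps One_nat_def)
qed

lemma q_rat_0: "q_rat 0 = 0"
proof -
  have nz: "Fraction_Field.Fract q 1 \<noteq> 0"
    by (simp add: Fraction_Field.Zero_fract_def Fraction_Field.eq_fract)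
  have "is_hj_expansion 2 [2]" by (simp add: is_hj_expansion_def)
  then have "hj_expansion 2 = [2]" by (rule hj_expansion_eqI)
  then have "q_rat 2 = Fraction_Field.Fract (M_mat [2] $$ (0, 0)) (M_mat [2] $$ (1, 0))"
    by (simp add: q_rat.simps[of 2])
  also have "\<dots> = Fraction_Field.Fract (q + 1) 1"
    unfolding M_mat_Cons_index by (simp add: q_int_def numeral_2_eq_2 add.commute)
  finally have 2: "q_rat 2 = Fraction_Field.Fract q 1 + 1"
    by (simp add: Fraction_Field.One_fract_def add.commute)
  have 1: "q_rat 1 = 1" using q_rat_add_1[of 1] 2 nz by simp
  show ?thesis using q_rat_add_1[of 0] 1 nz by simp
qed


subsection \<open>Cyclotomic polynomials\<close>

lemma prod_complex_cyclotomic: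
  assumes "n > 0"
  shows "(\<Prod>d | d dvd n. complex_cyclotomic d) = monom 1 n - 1"
proof -
  define g where "g = (\<lambda>k. [:- cis (2 * pi * real k / real n), 1:])"
  define A where "A = (\<lambda>d. {k\<in>{0<..n}. gcd k n = d})"
  have A: "(\<Prod>k\<in>A d. g k) = complex_cyclotomic (n div d)" if "d dvd n" for d
  proof -
    have "(\<Prod>k\<in>A d. g k) = (\<Prod>k\<in>totatives (n div d). g (k * d))"
      unfolding A_def using bij_betw_totatives_gcd_eq[OF that assms]
      by (rule prod.reindex_bij_betw [symmetric])
    also have "\<dots> = complex_cyclotomic (n div d)"
      unfolding complex_cyclotomic_def g_def
      using that assms by (intro prod.cong) (auto elim!: dvdE simp: field_simps)
    finally show ?thesis .
  qed
  have "(\<Prod>d | d dvd n. complex_cyclotomic d) = (\<Prod>d | d dvd n. complex_cyclotomic (n div d))"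
    using assms by (intro prod.reindex_bij_witness[of _ "(div) n" "(div) n"]) (auto elim: dvdE)
  also have "\<dots> = (\<Prod>d | d dvd n. \<Prod>k\<in>A d. g k)"
    by (intro prod.cong refl A [symmetric]) auto
  also have "\<dots> = (\<Prod>k\<in>(\<Union>d\<in>{d. d dvd n}. A d). g k)"
    using assms by (intro prod.UNION_disjoint [symmetric]) (auto simp: A_def)
  also have "(\<Union>d\<in>{d. d dvd n}. A d) = {0<..n}"
    by (auto simp: A_def)
  also have "(\<Prod>k\<in>{0<..n}. g k) = (\<Prod>k<n. g k)"
  proof -
    have e: "{0<..n} = insert n {1..<n}" "{..<n} = insert 0 {1..<n}" using assms by auto
    have "g n = g 0" using assms by (simp add: g_def)
    then show ?thesis unfolding e by simp
  qed
  also have "\<dots> = (\<Prod>z | z ^ n = 1. [:- z, 1:])"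
    unfolding g_def using bij_betw_roots_unity[OF assms] by (rule prod.reindex_bij_betw)
  also have "\<dots> = monom 1 n - 1"
  proof -
    let ?p = "monom 1 n - 1 :: complex poly"
    have "?p = (- 1) + monom 1 n" by simp
    also have "lead_coeff \<dots> = 1"
      using assms by (subst lead_coeff_add_le) (simp_all add: degree_monom_eq)
    finally have lc: "lead_coeff ?p = 1" .
    have "rsquarefree ?p"
      unfolding rsquarefree_roots
      using assms by (auto simp: poly_monom pderiv_diff pderiv_monom power_0_left split: if_splits)
    then have "Polynomial.smult (lead_coeff ?p) (\<Prod>z | poly ?p z = 0. [:- z, 1:]) = ?p"
      by (rule complex_poly_decompose_rsquarefree)
    then show ?thesis unfolding lc by (simp add: poly_monom)
  qed
  finally show ?thesis .
qed

lemma complex_cyclotomic_int: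
  "n > 0 \<Longrightarrow> \<exists>p :: int poly. map_poly of_int p = complex_cyclotomic n \<and> lead_coeff p = 1"
proof (induction n rule: less_induct)
  case (less n)
  define D where "D = {d. d dvd n \<and> d \<noteq> n}"
  have "\<forall>d\<in>D. \<exists>p :: int poly. map_poly of_int p = complex_cyclotomic d \<and> lead_coeff p = 1"
  proof
    fix d assume "d \<in> D"
    then have "d < n" "d > 0" using less.prems dvd_imp_le[of d n] by (auto simp: D_def intro: Nat.gr0I)
    then show "\<exists>p :: int poly. map_poly of_int p = complex_cyclotomic d \<and> lead_coeff p = 1"
      by (rule less.IH)
  qed
  then obtain f :: "nat \<Rightarrow> int poly" where
    f: "\<And>d. d \<in> D \<Longrightarrow> map_poly of_int (f d) = complex_cyclotomic d \<and> lead_coeff (f d) = 1"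
    by metis
  define P where "P = (\<Prod>d\<in>D. f d)"
  have lcP: "lead_coeff P = 1" unfolding P_def by (simp add: lead_coeff_prod f)
  then have "P \<noteq> 0" by auto
  let ?h = "map_poly of_int :: int poly \<Rightarrow> complex poly"
  obtain Q R where QR: "pseudo_divmod (monom 1 n - 1) P = (Q, R)" by fastforce
  have eq: "monom 1 n - 1 = P * Q + R" and R: "R = 0 \<or> degree R < degree P"
    using pseudo_divmod[OF \<open>P \<noteq> 0\<close> QR] lcP by auto
  have "{d. d dvd n} = insert n D" "finite D" "n \<notin> D" using less.prems by (auto simp: D_def)
  then have "monom 1 n - 1 = complex_cyclotomic n * (\<Prod>d\<in>D. complex_cyclotomic d)"
    using prod_complex_cyclotomic[OF less.prems] by simp
  also have "(\<Prod>d\<in>D. complex_cyclotomic d) = ?h P"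
    unfolding P_def of_int_poly_hom.hom_prod using f by (intro prod.cong) auto
  finally have 1: "monom 1 n - 1 = complex_cyclotomic n * ?h P" .
  have "?h (monom 1 n - 1) = ?h P * ?h Q + ?h R"
    unfolding eq by (simp add: hom_distribs)
  moreover have "?h (monom 1 n - 1) = monom 1 n - 1" by (simp add: hom_distribs)
  ultimately have 2: "?h R = ?h P * (complex_cyclotomic n - ?h Q)"
    using 1 by (simp add: algebra_simps)
  have "complex_cyclotomic n = ?h Q"
  proof (rule ccontr)
    assume ne: "complex_cyclotomic n \<noteq> ?h Q"
    have "?h P \<noteq> 0" using \<open>P \<noteq> 0\<close> by simp
    then have "degree (?h R) = degree (?h P) + degree (complex_cyclotomic n - ?h Q)" "?h R \<noteq> 0"
      using 2 ne by (auto simp: degree_mult_eq)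
    then show False using R by auto
  qed
  moreover have "lead_coeff (complex_cyclotomic n) = 1"
    unfolding complex_cyclotomic_def by (simp add: lead_coeff_prod)
  ultimately have "map_poly of_int Q = complex_cyclotomic n \<and> lead_coeff Q = 1"
    by (metis of_int_eq_1_iff of_int_hom.hom_lead_coeff)
  then show ?case by blast
qed

theorem map_poly_cyclotomic:
  assumes "n > 0"
  shows "map_poly of_int (cyclotomic n) = complex_cyclotomic n"
proof -
  obtain p :: "int poly" where p: "map_poly of_int p = complex_cyclotomic n"
    using complex_cyclotomic_int[OF assms] by blast
  have "(map_poly of_int p :: complex poly) = map_poly of_int r \<longleftrightarrow> p = r" for p r
    by (rule of_int_poly_hom.eq_iff)
  then have "cyclotomic n = p" unfolding cyclotomic_def using p by (metis (mono_tags, lifting) the_equality)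
  then show ?thesis using p by simp
qed

end

theory Submission
  imports Defs
begin

text \<open>The matrices \<open>R\<^sub>q\<close> and \<open>S\<^sub>q\<close> are products of two semilinear reflections, where the
  semilinear structure comes from \<open>q \<mapsto> 1/q\<close>. Modulo \<open>[n]\<^sub>q\<close> and up to units these reflections
  satisfy the relations of the Coxeter group of type \<open>(2, 3, n)\<close>, while at a primitive \<open>n\<close>-th root of
  unity the Hermitian forms on \<open>\<complex>\<^sup>2\<close> realise its geometric representation. If \<open>\<Phi>\<^sub>n\<close> divides the
  denominator, the word producing \<open>r/s\<close> fixes a fundamental weight up to scaling, and by Tits'
  theorem on stabilizers it is equivalent to a word in the two reflections generating \<open>R\<^sub>q\<close>.
  Modulo \<open>[n]\<^sub>q\<close> such a word has lower entry \<open>0\<close> and upper entry a unit, and the congruences for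
  \<open>r\<close> and \<open>s\<close> follow at \<open>q = 1\<close>. For the numerator, multiply by \<open>S\<^sub>q\<close> first.\<close>

section \<open>Coxeter groups and the numbers game\<close>

fun alt :: "'g \<Rightarrow> 'g \<Rightarrow> nat \<Rightarrow> 'g list" where
  "alt s t 0 = []"
| "alt s t (Suc k) = s # alt t s k"

lemma length_alt [simp]: "length (alt s t k) = k"
  by (induction k arbitrary: s t) auto

lemma alt_Suc_snoc: "alt s t (Suc k) = alt s t k @ [if even k then s else t]"
  by (induction k arbitrary: s t) auto

lemma alt_add: "\<exists>xs. alt s t (j + k) = alt s t j @ xs"
  by (induction j arbitrary: s t) auto

lemma alt_double: "alt s t (2 * k) = concat (replicate k [s, t])"
  by (induction k) auto

locale coxeter_matrix =
  fixes m :: "'g \<Rightarrow> 'g \<Rightarrow> nat"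
  assumes m_sym: "m s t = m t s"
    and m_ge_2: "s \<noteq> t \<Longrightarrow> 2 \<le> m s t"
begin

text \<open>Equality in the Coxeter group. The relations carry an arbitrary tail \<open>w\<close>
  and \<open>word_eq_Cons\<close> supplies prefixes, so they apply anywhere in a word.\<close>

inductive word_eq :: "'g list \<Rightarrow> 'g list \<Rightarrow> bool" (infix "\<approx>" 50) where
  word_eq_refl [intro, simp]: "w \<approx> w"
| word_eq_sym: "v \<approx> w \<Longrightarrow> w \<approx> v"
| word_eq_trans [trans]: "u \<approx> v \<Longrightarrow> v \<approx> w \<Longrightarrow> u \<approx> w"
| word_eq_Cons: "v \<approx> w \<Longrightarrow> s # v \<approx> s # w"
| word_eq_square: "s # s # w \<approx> w"
| word_eq_relation: "s \<noteq> t \<Longrightarrow> alt s t (2 * m s t) @ w \<approx> w"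

lemma word_eq_append: "v \<approx> w \<Longrightarrow> u @ v \<approx> u @ w"
  by (induction u) (auto intro: word_eq_Cons)

lemma word_eq_cancel: "u @ s # s # w \<approx> u @ w"
  by (intro word_eq_append word_eq_square)

lemma word_eq_parity: "v \<approx> w \<Longrightarrow> even (length v) = even (length w)"
  by (induction rule: word_eq.induct) auto

text \<open>The trivial word \<open>alt s t (2 * m s t)\<close> cancels letter by letter against a
  following \<open>alt t s j\<close>; stopping halfway, at \<open>j = m s t\<close>, leaves
  \<open>alt s t (m s t)\<close>.\<close>

lemma braid:
  assumes "s \<noteq> t"
  shows "alt s t (m s t) @ w \<approx> alt t s (m s t) @ w"
proof -
  let ?m = "m s t"
  have "alt s t (2 * ?m) @ alt t s j @ w \<approx> alt s t (2 * ?m - j) @ w" if "j \<le> 2 * ?m" for j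
    using that
  proof (induction j arbitrary: w)
    case (Suc j)
    define x where "x = (if even j then t else s)"
    define k where "k = 2 * ?m - Suc j"
    have k: "2 * ?m - j = Suc k" and "even k \<longleftrightarrow> odd j" using Suc.prems by (auto simp: k_def)
    then have a: "alt s t (2 * ?m - j) = alt s t k @ [x]"
      by (simp only: k alt_Suc_snoc) (simp add: x_def)
    have "alt s t (2 * ?m) @ alt t s (Suc j) @ w = alt s t (2 * ?m) @ alt t s j @ x # w"
      by (simp only: alt_Suc_snoc x_def) simp
    also have "\<dots> \<approx> alt s t (2 * ?m - j) @ x # w" using Suc by simp
    also have "\<dots> \<approx> alt s t k @ w" using word_eq_cancel by (simp add: a)
    finally show ?case by (simp only: k_def)
  qed simp
  from this[of ?m] have "alt s t (2 * ?m) @ alt t s ?m @ w \<approx> alt s t ?m @ w" by simp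
  moreover have "alt s t (2 * ?m) @ alt t s ?m @ w \<approx> alt t s ?m @ w"
    using assms by (rule word_eq_relation)
  ultimately show ?thesis by (blast intro: word_eq_sym word_eq_trans)
qed

section \<open>Reduced words\<close>

definition reduced :: "'g list \<Rightarrow> bool" where
  "reduced w \<longleftrightarrow> (\<forall>w'. w \<approx> w' \<longrightarrow> length w \<le> length w')"

lemma reducedD: "reduced w \<Longrightarrow> w \<approx> w' \<Longrightarrow> length w \<le> length w'"
  by (simp add: reduced_def)

lemma ex_reduced: "\<exists>w'. w \<approx> w' \<and> reduced w'"
proof -
  obtain w' where "w \<approx> w'" "\<forall>v. w \<approx> v \<longrightarrow> length w' \<le> length v"
    using ex_has_least_nat[of "\<lambda>v. w \<approx> v" w length] by auto
  then show ?thesis unfolding reduced_def by (blast intro: word_eq_trans)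
qed

lemma reduced_word_eq: "reduced w \<Longrightarrow> w \<approx> w' \<Longrightarrow> length w' = length w \<Longrightarrow> reduced w'"
  unfolding reduced_def by (metis word_eq_trans)

lemma reduced_append: "reduced (u @ v) \<Longrightarrow> reduced v"
  unfolding reduced_def using word_eq_append by fastforce

text \<open>Parity forbids that prefixing a letter keeps the minimal length. So the length drops by
  one, and multiplying back by \<open>x\<close> gives an equally short expression of
  \<open>v\<close> that starts with \<open>x\<close>.\<close>

lemma not_reduced_ConsD:
  assumes "reduced v" "\<not> reduced (x # v)"
  shows "\<exists>v'. v \<approx> x # v' \<and> Suc (length v') = length v"
proof -
  obtain v' where v': "x # v \<approx> v'" "length v' \<le> length v"
    using assms(2) by (auto simp: reduced_def not_le less_Suc_eq_le)
  have "v \<approx> x # x # v" by (rule word_eq_sym[OF word_eq_square])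
  also have "\<dots> \<approx> x # v'" using v' by (intro word_eq_Cons)
  finally have e: "v \<approx> x # v'" .
  then have "length v \<le> Suc (length v')" using reducedD[OF assms(1)] by fastforce
  moreover have "even (length v) \<noteq> even (length v')" using word_eq_parity[OF v'(1)] by auto
  ultimately have "Suc (length v') = length v" using v'(2) by (metis le_SucE le_antisym)
  with e show ?thesis by blast
qed

text \<open>Mozes' numbers game: \<open>f s\<close> is the pairing of a point of the contragredient geometric
  representation with the simple root \<open>s\<close>.\<close>

definition weight :: "'g \<Rightarrow> 'g \<Rightarrow> real" where
  "weight s t = (if s = t then -2 else 2 * cos (pi / real (m s t)))"

definition fire :: "'g \<Rightarrow> ('g \<Rightarrow> real) \<Rightarrow> 'g \<Rightarrow> real" where
  "fire s f t = f t + weight s t * f s"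

abbreviation play :: "'g list \<Rightarrow> ('g \<Rightarrow> real) \<Rightarrow> 'g \<Rightarrow> real" where
  "play \<equiv> foldr fire"

lemma fire_same [simp]: "fire s f s = - f s"
  by (simp add: fire_def weight_def)

lemma weight_sym: "weight s t = weight t s"
  by (simp add: weight_def m_sym)

lemma fire_fire [simp]: "fire s (fire s f) = f"
  by (rule ext) (simp add: fire_def weight_def)

text \<open>Each alternating firing is one step of the three-term recurrence satisfied by sin (j
  \<theta>); the factor \<open>sin \<theta>\<close> avoids divisions. Since \<open>foldr\<close>
  fires from the right end of the word, \<open>x\<close> is the coordinate at the node fired
  first.\<close>

lemma play_alt:
  assumes "s \<noteq> t" and "\<theta> = pi / real (m s t)"
    and "x = (if even j then f s else f t)" and "y = (if even j then f t else f s)"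
  shows "sin \<theta> * play (alt t s j) f s = sin (real (Suc j) * \<theta>) * x + sin (real j * \<theta>) * y"
    and "sin \<theta> * play (alt t s j) f t = - (sin (real j * \<theta>) * x + sin ((real j - 1) * \<theta>) * y)"
proof -
  have "sin \<theta> * play (alt t s j) f s = sin (real (Suc j) * \<theta>) * x + sin (real j * \<theta>) * y \<and>
    sin \<theta> * play (alt t s j) f t = - (sin (real j * \<theta>) * x + sin ((real j - 1) * \<theta>) * y)"
    using assms
  proof (induction j arbitrary: s t x y)
    case (Suc j)
    define g where "g = play (alt s t j) f"
    have "\<theta> = pi / real (m t s)" using Suc.prems(2) m_sym by simp
    then have IH: "sin \<theta> * g t = sin (real (Suc j) * \<theta>) * x + sin (real j * \<theta>) * y"
      "sin \<theta> * g s = - (sin (real j * \<theta>) * x + sin ((real j - 1) * \<theta>) * y)"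
      unfolding g_def using Suc.IH[of t s x y] Suc.prems by auto
    have w: "weight t s = 2 * cos \<theta>" using Suc.prems m_sym by (simp add: weight_def)
    have rec: "2 * cos \<theta> * sin (z * \<theta>) - sin ((z - 1) * \<theta>) = sin ((z + 1) * \<theta>)" for z :: real
      by (simp add: algebra_simps sin_add sin_diff)
    have "sin \<theta> * fire t g s = sin \<theta> * g s + 2 * cos \<theta> * (sin \<theta> * g t)"
      by (simp add: fire_def w algebra_simps)
    also have "\<dots> = (2 * cos \<theta> * sin (real (Suc j) * \<theta>) - sin ((real (Suc j) - 1) * \<theta>)) * x
        + (2 * cos \<theta> * sin (real j * \<theta>) - sin ((real j - 1) * \<theta>)) * y"
      unfolding IH by (simp add: algebra_simps)
    also have "\<dots> = sin (real (Suc (Suc j)) * \<theta>) * x + sin (real (Suc j) * \<theta>) * y"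
      unfolding rec by (simp add: algebra_simps)
    finally show ?case using IH(1) by (simp add: g_def[symmetric] algebra_simps)
  qed simp
  then show "sin \<theta> * play (alt t s j) f s = sin (real (Suc j) * \<theta>) * x + sin (real j * \<theta>) * y"
    and "sin \<theta> * play (alt t s j) f t = - (sin (real j * \<theta>) * x + sin ((real j - 1) * \<theta>) * y)"
    by blast+
qed

lemma angle_bounds:
  assumes "s \<noteq> t" and "\<theta> = pi / real (m s t)"
  shows "0 < \<theta>" "\<theta> < pi" "sin \<theta> > 0"
proof -
  have "real (m s t) \<ge> 2" using m_ge_2[OF assms(1)] by simp
  then show "0 < \<theta>" "\<theta> < pi" using assms(2) by (simp_all add: divide_less_eq)
  then show "sin \<theta> > 0" by (rule sin_gt_zero)
qed

text \<open>The \<open>2 * m s t\<close> firings advance the angle by 2 pi, which restores the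
  coordinates at \<open>s\<close> and \<open>t\<close> by \<open>play_alt\<close>. Any other
  coordinate is then recovered from an invariant linear combination.\<close>

lemma play_relation:
  assumes "s \<noteq> t"
  shows "play (alt s t (2 * m s t)) f = f"
proof
  fix r
  define \<theta> where "\<theta> = pi / real (m s t)"
  note \<theta> = angle_bounds[OF assms \<theta>_def]
  let ?M = "2 * m s t"
  have mpos: "real (m s t) > 0" using m_ge_2[OF assms] by simp
  have M: "real ?M * \<theta> = 2 * pi" using mpos by (simp add: \<theta>_def)
  have sM: "sin (real ?M * \<theta>) = 0" unfolding M by simp
  have s1: "sin (real (Suc ?M) * \<theta>) = sin \<theta>"
  proof -
    have "real (Suc ?M) * \<theta> = \<theta> + 2 * pi" using M by (simp add: algebra_simps)
    then show ?thesis by simp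
  qed
  have s2: "sin ((real ?M - 1) * \<theta>) = - sin \<theta>"
  proof -
    have "(real ?M - 1) * \<theta> = 2 * pi - \<theta>" using M by (simp add: algebra_simps)
    then show ?thesis by (simp add: sin_diff)
  qed
  have th: "\<theta> = pi / real (m t s)" using m_sym by (simp add: \<theta>_def)
  have t: "play (alt s t ?M) f t = f t"
    using play_alt(1)[OF assms[symmetric] th refl refl, where f = f and j = ?M] \<theta>(3) unfolding sM s1 by simp
  have s: "play (alt s t ?M) f s = f s"
    using play_alt(2)[OF assms[symmetric] th refl refl, where f = f and j = ?M] \<theta>(3) unfolding sM s2 by simp
  show "play (alt s t ?M) f r = f r"
  proof (cases "r = s \<or> r = t")
    case False
    define c where "c = weight s t"
    have c: "c = 2 * cos \<theta>" using assms by (simp add: c_def weight_def \<theta>_def)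
    have "4 - c\<^sup>2 = 4 * (sin \<theta>)\<^sup>2" unfolding c by (simp add: sin_squared_eq power_mult_distrib)
    then have d: "4 - c\<^sup>2 \<noteq> 0" using \<theta>(3) by simp
    \<comment> \<open>Cramer's rule for the two linear equations below, whose determinant is
      \<open>4 - c\<^sup>2\<close>.\<close>
    define x where "x = (2 * weight s r + c * weight t r) / (4 - c\<^sup>2)"
    define y where "y = (2 * weight t r + c * weight s r) / (4 - c\<^sup>2)"
    have x: "weight s r = 2 * x - c * y" and y: "weight t r = 2 * y - c * x"
      using d unfolding x_def y_def by (simp_all add: divide_simps) (simp_all add: algebra_simps power2_eq_square)
    \<comment> \<open>The coefficients are chosen such that \<open>I\<close> is invariant under \<open>s\<close> and \<open>t\<close>.\<close>
    define I where "I = (\<lambda>g. g r + x * g s + y * g t)"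
    have "I (fire s g) = I g" "I (fire t g) = I g" for g
      using weight_sym[of t s]
      by (simp_all add: I_def fire_def x y c_def[symmetric] algebra_simps)
    then have "I (play (alt s t j) g) = I g \<and> I (play (alt t s j) g) = I g" for j g
      by (induction j) auto
    then have "I (play (alt s t ?M) f) = I f" by blast
    then show ?thesis using s t by (simp add: I_def)
  qed (use s t in auto)
qed

section \<open>Tits' positivity and stabilizer theorems\<close>

lemma play_eq_0: "play w f = (\<lambda>_. 0) \<Longrightarrow> f = (\<lambda>_. 0)"
proof (induction w)
  case (Cons s w)
  then have "play w f = fire s (\<lambda>_. 0)" by (metis fire_fire foldr_Cons o_apply)
  also have "\<dots> = (\<lambda>_. 0)" by (rule ext) (simp add: fire_def)
  finally show ?case by (rule Cons.IH)
qed simp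

lemma play_cong: "v \<approx> w \<Longrightarrow> play v f = play w f"
  by (induction rule: word_eq.induct) (simp_all add: play_relation)

text \<open>Tits' argument: split off a maximal alternating prefix of \<open>w\<close> in \<open>s\<close> and the first letter
  of \<open>w\<close>; what is left keeps both coordinates nonnegative by induction, and the prefix is too
  short to make the coordinate at \<open>s\<close> negative.\<close>

lemma play_nonneg:
  assumes "\<And>r. f r \<ge> 0" and "reduced (s # w)"
  shows "play w f s \<ge> 0"
  using assms(2)
proof (induction "length w" arbitrary: w s rule: less_induct)
  case less
  note sw = less.prems
  have w: "reduced w" using sw reduced_append[of "[s]" w] by simp
  show ?case
  proof (cases w)
    case Nil
    then show ?thesis using assms(1) by simp
  next
    case (Cons t w1)
    have st: "s \<noteq> t"
    proof
      assume "s = t"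
      then have "s # w \<approx> w1" using word_eq_square by (simp add: Cons)
      then show False using reducedD[OF sw] by (fastforce simp: Cons)
    qed
    define P where "P = (\<lambda>j. \<exists>v. w \<approx> alt t s j @ v \<and> j + length v = length w)"
    \<comment> \<open>The first letter \<open>t\<close> already is an alternating prefix, so
      \<open>1 \<le> j\<close> and \<open>v\<close> is shorter than \<open>w\<close>, as the
      induction needs.\<close>
    have "P 1" unfolding P_def by (rule exI[of _ w1]) (simp add: Cons)
    moreover have bound: "\<And>j. P j \<Longrightarrow> j \<le> length w" unfolding P_def by auto
    ultimately obtain j where j: "P j" and max: "\<And>i. P i \<Longrightarrow> i \<le> j" and "1 \<le> j"
      using GreatestI_nat[of P 1 "length w"] Greatest_le_nat[of P _ "length w"] by metis
    then obtain i where i: "j = Suc i" by (cases j) auto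
    obtain v where v: "w \<approx> alt t s j @ v" "j + length v = length w"
      using j unfolding P_def by blast
    have rv: "reduced v" using reduced_append reduced_word_eq[OF w v(1)] v(2) by auto
    have "reduced (x # v)" if x: "x \<in> {s, t}" for x
    proof (rule ccontr)
      assume "\<not> reduced (x # v)"
      then obtain v' where v': "v \<approx> x # v'" "Suc (length v') = length v"
        using not_reduced_ConsD[OF rv] by blast
      have e: "w \<approx> alt t s j @ x # v'" using v(1) word_eq_append[OF v'(1)] word_eq_trans by blast
      show False
      \<comment> \<open>The letter \<open>x\<close> either continues the prefix, against the
        maximality of \<open>j\<close>, or equals its last letter, and then the two cancel and
        shorten \<open>w\<close>.\<close>
      proof (cases "x = (if even j then t else s)")
        case True
        then have "w \<approx> alt t s (Suc j) @ v'" using e unfolding alt_Suc_snoc by simp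
        then have "P (Suc j)" unfolding P_def using v v' by (intro exI[of _ v']) auto
        then show False using max by fastforce
      next
        case False
        then have "x = (if even i then t else s)" using x i by auto
        then have "alt t s j = alt t s i @ [x]" unfolding i alt_Suc_snoc by simp
        then have "w \<approx> alt t s i @ v'" using e word_eq_cancel word_eq_trans by fastforce
        then show False using reducedD[OF w] v v' i by fastforce
      qed
    qed
    moreover have "length v < length w" using v(2) \<open>1 \<le> j\<close> by simp
    ultimately have pos: "play v f s \<ge> 0" "play v f t \<ge> 0" using less.hyps by auto
    \<comment> \<open>A longer prefix could be rewritten by \<open>braid\<close> to start with
      \<open>s\<close>, which would cancel the leading letter of the reduced word
      \<open>s # w\<close>.\<close>
    have "j < m s t"
    proof (rule ccontr)
      assume "\<not> j < m s t"
      then obtain k where k: "j = m s t + k" by (metis le_iff_add not_less)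
      obtain xs where xs: "alt t s j = alt t s (m s t) @ xs" using alt_add[of t s "m s t" k] k by auto
      obtain l where l: "m s t = Suc l" using m_ge_2[OF st] by (cases "m s t") auto
      have "s # w \<approx> s # alt t s (m s t) @ xs @ v" using word_eq_Cons[OF v(1)] xs by simp
      also have "\<dots> \<approx> s # alt s t (m s t) @ xs @ v" by (rule word_eq_Cons[OF word_eq_sym[OF braid[OF st]]])
      also have "\<dots> = s # s # alt t s l @ xs @ v" by (simp add: l)
      also have "\<dots> \<approx> alt t s l @ xs @ v" by (rule word_eq_square)
      finally have "length (s # w) \<le> length (alt t s l @ xs @ v)" by (rule reducedD[OF sw])
      moreover have "length xs = k" using arg_cong[OF xs, of length] k by simp
      ultimately show False using v(2) k l by simp
    qed
    define \<theta> where "\<theta> = pi / real (m s t)"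
    note \<theta> = angle_bounds[OF st \<theta>_def]
    \<comment> \<open>As \<open>j < m s t\<close>, the angles of both sines in
      \<open>play_alt\<close> stay between 0 and pi.\<close>
    have sins: "sin (real i * \<theta>) \<ge> 0" if "i \<le> m s t" for i
    proof (rule sin_ge_zero)
      have "real i * \<theta> \<le> real (m s t) * \<theta>" using that \<theta>(1) by (intro mult_right_mono) auto
      also have "\<dots> = pi" using m_ge_2[OF st] by (simp add: \<theta>_def)
      finally show "real i * \<theta> \<le> pi" .
    qed (use \<theta>(1) in simp)
    have "sin \<theta> * play (alt t s j) (play v f) s \<ge> 0"
      using pos sins[of "Suc j"] sins[of j] \<open>j < m s t\<close>
      by (subst play_alt(1)[OF st \<theta>_def refl refl]) (auto intro!: add_nonneg_nonneg mult_nonneg_nonneg simp del: of_nat_Suc)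
    then have "play (alt t s j) (play v f) s \<ge> 0" using \<theta>(3) by (simp add: zero_le_mult_iff)
    then show ?thesis using play_cong[OF v(1), of f] by simp
  qed
qed

text \<open>For the first letter \<open>s\<close> of a reduced word, \<open>play_nonneg\<close>
  makes the coordinate at \<open>s\<close> before the last firing nonnegative, while the scaling
  hypothesis makes it \<open>- (c * f s)\<close>. Hence \<open>f s = 0\<close>, firing
  \<open>s\<close> changes nothing, and the letter can be peeled off.\<close>

theorem stabilizer_parabolic:
  assumes "\<And>r. f r \<ge> 0" and "c > 0" and "play w f = (\<lambda>r. c * f r)"
  shows "\<exists>w'. w \<approx> w' \<and> (\<forall>r\<in>set w'. f r = 0)"
proof -
  have red: "\<forall>r\<in>set w. f r = 0" if "reduced w" "play w f = (\<lambda>r. c * f r)" for w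
    using that
  proof (induction w)
    case (Cons s w)
    have "play w f s \<ge> 0" using play_nonneg[OF assms(1) Cons.prems(1)] .
    moreover have e: "fire s (play w f) = (\<lambda>r. c * f r)" using Cons.prems(2) by simp
    then have "- play w f s = c * f s" using fire_same by metis
    ultimately have "c * f s \<le> 0" by linarith
    then have 0: "f s = 0" using assms(1)[of s] assms(2) by (simp add: mult_le_0_iff)
    have "play w f = fire s (\<lambda>r. c * f r)" using e fire_fire by metis
    also have "\<dots> = (\<lambda>r. c * f r)" using 0 by (auto simp: fire_def)
    finally have "play w f = (\<lambda>r. c * f r)" .
    moreover have "reduced w" using Cons.prems(1) reduced_append[of "[s]" w] by simp
    ultimately have "\<forall>r\<in>set w. f r = 0" using Cons.IH by blast
    then show ?case using 0 by simp
  qed simp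
  obtain w' where "w \<approx> w'" "reduced w'" using ex_reduced by blast
  then show ?thesis using red assms(3) play_cong by metis
qed

end


section \<open>Evaluation of Laurent polynomials\<close>

text \<open>Substitution of \<open>u\<close> for \<open>q\<close>; the inverse \<open>v\<close> is
  passed explicitly because the target is only an integral domain. If \<open>u * v = 1\<close>,
  every power of \<open>q\<close> that clears the negative exponents gives the same value.\<close>

definition laurent_eval :: "'a::{idom,ring_char_0} \<Rightarrow> 'a \<Rightarrow> laurent \<Rightarrow> 'a" where
  "laurent_eval u v f = (THE z. \<exists>k p. q ^ k * f = of_poly p \<and> z = v ^ k * poly (map_poly of_int p) u)"

context
  fixes u v :: "'a::{idom,ring_char_0}"
  assumes uv: "u * v = 1"
begin

private lemma powers_cancel: "v ^ k * (u ^ k * z) = z" "u ^ k * (v ^ k * z) = z"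
proof -
  have "(u * v) ^ k * z = z" by (simp add: uv)
  then show "v ^ k * (u ^ k * z) = z" "u ^ k * (v ^ k * z) = z"
    by (simp_all only: power_mult_distrib ac_simps)
qed

lemma laurent_eval_eqI:
  assumes "q ^ k * f = of_poly p"
  shows "laurent_eval u v f = v ^ k * poly (map_poly of_int p) u"
  unfolding laurent_eval_def
proof (rule the_equality)
  show "\<exists>k' p'. q ^ k' * f = of_poly p' \<and>
      v ^ k * poly (map_poly of_int p) u = v ^ k' * poly (map_poly of_int p') u"
    using assms by blast
next
  fix z assume "\<exists>k' p'. q ^ k' * f = of_poly p' \<and> z = v ^ k' * poly (map_poly of_int p') u"
  then obtain k' p' where p': "q ^ k' * f = of_poly p'" "z = v ^ k' * poly (map_poly of_int p') u"
    by blast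
  have "q ^ k' * of_poly p = q ^ k * of_poly p'"
    unfolding assms[symmetric] p'(1)[symmetric] by (simp only: ac_simps)
  then have "of_poly ([:0, 1:] ^ k' * p) = of_poly ([:0, 1:] ^ k * p')" by simp
  then have "[:0, 1:] ^ k' * p = [:0, 1:] ^ k * p'" by (simp only: of_poly_inject)
  then have "poly (map_poly of_int ([:0, 1:] ^ k' * p)) u = poly (map_poly of_int ([:0, 1:] ^ k * p')) u"
    by simp
  then have e: "u ^ k' * poly (map_poly of_int p) u = u ^ k * poly (map_poly of_int p') u"
    by (simp add: hom_distribs)
  have "z = v ^ k' * (v ^ k * (u ^ k * poly (map_poly of_int p') u))"
    unfolding powers_cancel p'(2) ..
  also have "\<dots> = v ^ k * (v ^ k' * (u ^ k' * poly (map_poly of_int p) u))"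
    unfolding e[symmetric] by (simp only: ac_simps)
  finally show "z = v ^ k * poly (map_poly of_int p) u" unfolding powers_cancel .
qed

lemma laurent_eval_of_poly: "laurent_eval u v (of_poly p) = poly (map_poly of_int p) u"
  using laurent_eval_eqI[of 0 "of_poly p" p] by simp

lemma laurent_eval_0 [simp]: "laurent_eval u v 0 = 0"
  using laurent_eval_of_poly[of 0] by simp

lemma laurent_eval_1 [simp]: "laurent_eval u v 1 = 1"
  using laurent_eval_of_poly[of 1] by simp

lemma laurent_eval_q [simp]: "laurent_eval u v q = u"
  using laurent_eval_of_poly[of "[:0, 1:]"] by simp

lemma laurent_eval_add [simp]: "laurent_eval u v (f + g) = laurent_eval u v f + laurent_eval u v g"
proof -
  obtain k p where p: "q ^ k * f = of_poly p" using laurent_times_q_power by blast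
  obtain l r where r: "q ^ l * g = of_poly r" using laurent_times_q_power by blast
  have "q ^ (k + l) * (f + g) = q ^ l * (q ^ k * f) + q ^ k * (q ^ l * g)"
    by (simp add: algebra_simps power_add)
  also have "\<dots> = of_poly ([:0, 1:] ^ l * p + [:0, 1:] ^ k * r)" by (simp add: p r)
  finally have "laurent_eval u v (f + g) = v ^ k * (v ^ l * (u ^ l * poly (map_poly of_int p) u))
      + v ^ l * (v ^ k * (u ^ k * poly (map_poly of_int r) u))"
    by (subst laurent_eval_eqI, assumption) (simp add: hom_distribs algebra_simps power_add)
  then show ?thesis using laurent_eval_eqI[OF p] laurent_eval_eqI[OF r] by (simp add: powers_cancel)
qed

lemma laurent_eval_mult [simp]: "laurent_eval u v (f * g) = laurent_eval u v f * laurent_eval u v g"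
proof -
  obtain k p where p: "q ^ k * f = of_poly p" using laurent_times_q_power by blast
  obtain l r where r: "q ^ l * g = of_poly r" using laurent_times_q_power by blast
  have "q ^ (k + l) * (f * g) = (q ^ k * f) * (q ^ l * g)"
    by (simp add: ac_simps power_add)
  also have "\<dots> = of_poly (p * r)" by (simp add: p r)
  finally have "laurent_eval u v (f * g) = v ^ (k + l) * poly (map_poly of_int (p * r)) u"
    by (rule laurent_eval_eqI)
  then show ?thesis
    using laurent_eval_eqI[OF p] laurent_eval_eqI[OF r] by (simp add: hom_distribs power_add)
qed

lemma laurent_eval_uminus [simp]: "laurent_eval u v (- f) = - laurent_eval u v f"
  using laurent_eval_add[of f "- f"] by (simp add: eq_neg_iff_add_eq_0 add.commute)

lemma laurent_eval_diff [simp]: "laurent_eval u v (f - g) = laurent_eval u v f - laurent_eval u v g"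
  using laurent_eval_add[of f "- g"] by simp

lemma laurent_eval_q_inv [simp]: "laurent_eval u v q_inv = v"
proof -
  have "u * laurent_eval u v q_inv = laurent_eval u v (q * q_inv)" unfolding laurent_eval_mult by simp
  then have "u * v * laurent_eval u v q_inv = v" by (simp add: mult.assoc mult.left_commute[of u v])
  then show ?thesis using uv by simp
qed

lemma laurent_eval_power [simp]: "laurent_eval u v (f ^ k) = laurent_eval u v f ^ k"
  by (induction k) auto

lemma laurent_eval_q_int: "laurent_eval u v (q_int k) = (\<Sum>i<k. u ^ i)"
  by (induction k) (auto simp: q_int_def)

lemma laurent_eval_dvd: "f dvd g \<Longrightarrow> laurent_eval u v f dvd laurent_eval u v g"
  by (auto elim!: dvdE)

end


section \<open>The mirrors of the triangle group\<close>

datatype mirror = MA | MB | MC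

text \<open>A quadruple \<open>(x, y, x', y')\<close> stands for a vector \<open>(x, y)\<close> together with its image
  \<open>(x', y')\<close> under the involution exchanging \<open>u = q\<close> and \<open>v = 1/q\<close>, so that the semilinear
  reflections become maps of a single kind. The matrices \<open>R\<^sub>q\<close> and \<open>S\<^sub>q\<close> are the products
  \<open>MB MA\<close> and \<open>MA MC\<close>.\<close>

fun reflect :: "'a::comm_ring_1 \<Rightarrow> 'a \<Rightarrow> mirror \<Rightarrow> 'a \<times> 'a \<times> 'a \<times> 'a \<Rightarrow> 'a \<times> 'a \<times> 'a \<times> 'a" where
  "reflect u v MA (x, y, x', y') = (- (v * x'), y', - (u * x), y)"
| "reflect u v MB (x, y, x', y') = (y' - x', y', y - x, y)"
| "reflect u v MC (x, y, x', y') = (y', x', y, x)"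

abbreviation act :: "'a::comm_ring_1 \<Rightarrow> 'a \<Rightarrow> mirror list \<Rightarrow> 'a \<times> 'a \<times> 'a \<times> 'a \<Rightarrow> 'a \<times> 'a \<times> 'a \<times> 'a" where
  "act u v \<equiv> foldr (reflect u v)"

fun order_mat :: "nat \<Rightarrow> mirror \<Rightarrow> mirror \<Rightarrow> nat" where
  "order_mat n MA MB = n"
| "order_mat n MB MA = n"
| "order_mat n MB MC = 3"
| "order_mat n MC MB = 3"
| "order_mat n MA MC = 2"
| "order_mat n MC MA = 2"
| "order_mat n MA MA = 1"
| "order_mat n MB MB = 1"
| "order_mat n MC MC = 1"

text \<open>The primed entries carry the inverse unit because the involution inverts \<open>\<plusminus>q\<^sup>k\<close>.\<close>

fun proj_cong :: "'a::comm_ring_1 \<Rightarrow> 'a \<times> 'a \<times> 'a \<times> 'a \<Rightarrow> 'a \<times> 'a \<times> 'a \<times> 'a \<Rightarrow> bool" where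
  "proj_cong N (x, y, x', y') (z, w, z', w') \<longleftrightarrow>
     (\<exists>e d. e * d = 1 \<and> N dvd x - e * z \<and> N dvd y - e * w \<and> N dvd x' - d * z' \<and> N dvd y' - d * w')"

lemma proj_congI:
  "e * d = 1 \<Longrightarrow> N dvd x - e * z \<Longrightarrow> N dvd y - e * w \<Longrightarrow> N dvd x' - d * z' \<Longrightarrow> N dvd y' - d * w' \<Longrightarrow>
    proj_cong N (x, y, x', y') (z, w, z', w')"
  by auto

lemma proj_cong_refl: "proj_cong N p p"
  by (cases p) (auto intro!: exI[of _ 1])

lemma proj_cong_sym:
  assumes "proj_cong N p r"
  shows "proj_cong N r p"
proof -
  have *: "N dvd z - d * x" if "N dvd x - e * z" "e * d = 1" for x z e d
  proof -
    have "z - d * x = - d * (x - e * z) + (1 - e * d) * z" by (simp add: algebra_simps)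
    also have "\<dots> = - d * (x - e * z)" unfolding that(2) by simp
    also have "N dvd \<dots>" by (rule dvd_mult[OF that(1)])
    finally show ?thesis .
  qed
  obtain x y x' y' z w z' w' where eq: "p = (x, y, x', y')" "r = (z, w, z', w')"
    by (cases p rule: prod_cases4, cases r rule: prod_cases4)
  obtain e d where ed: "e * d = 1" and
    dv: "N dvd x - e * z" "N dvd y - e * w" "N dvd x' - d * z'" "N dvd y' - d * w'"
    using assms unfolding eq proj_cong.simps by blast
  have de: "d * e = 1" using ed by (simp only: mult.commute)
  show ?thesis unfolding eq
    by (rule proj_congI[OF de *[OF dv(1) ed] *[OF dv(2) ed] *[OF dv(3) de] *[OF dv(4) de]])
qed

lemma proj_cong_trans:
  assumes "proj_cong N p r" and "proj_cong N r s"
  shows "proj_cong N p s"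
proof -
  have *: "N dvd x - (e * f) * t" if "N dvd x - e * z" "N dvd z - f * t" for x z e f t
  proof -
    have "x - (e * f) * t = (x - e * z) + e * (z - f * t)" by (simp add: algebra_simps)
    also have "N dvd \<dots>" by (intro dvd_add dvd_mult that)
    finally show ?thesis .
  qed
  obtain x y x' y' z w z' w' a b a' b' where
    eq: "p = (x, y, x', y')" "r = (z, w, z', w')" "s = (a, b, a', b')"
    by (cases p rule: prod_cases4, cases r rule: prod_cases4, cases s rule: prod_cases4)
  obtain e d where ed: "e * d = 1" and
    dv: "N dvd x - e * z" "N dvd y - e * w" "N dvd x' - d * z'" "N dvd y' - d * w'"
    using assms(1) unfolding eq proj_cong.simps by blast
  obtain f g where fg: "f * g = 1" and
    dv': "N dvd z - f * a" "N dvd w - f * b" "N dvd z' - g * a'" "N dvd w' - g * b'"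
    using assms(2) unfolding eq proj_cong.simps by blast
  have "(e * f) * (d * g) = (e * d) * (f * g)" by (simp only: ac_simps)
  then have "(e * f) * (d * g) = 1" by (simp add: ed fg)
  then show ?thesis unfolding eq
    by (rule proj_congI[OF _ *[OF dv(1) dv'(1)] *[OF dv(2) dv'(2)] *[OF dv(3) dv'(3)] *[OF dv(4) dv'(4)]])
qed

text \<open>Reflections swap the two halves of a quadruple, hence also the units \<open>e\<close>
  and \<open>d\<close>.\<close>

lemma proj_cong_reflect:
  assumes "proj_cong N p r"
  shows "proj_cong N (reflect u v s p) (reflect u v s r)"
proof -
  obtain x y x' y' z w z' w' where eq: "p = (x, y, x', y')" "r = (z, w, z', w')"
    by (cases p rule: prod_cases4, cases r rule: prod_cases4)
  obtain e d where ed: "e * d = 1" and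
    dv: "N dvd x - e * z" "N dvd y - e * w" "N dvd x' - d * z'" "N dvd y' - d * w'"
    using assms unfolding eq proj_cong.simps by blast
  have *: "N dvd - (c * x) - e * - (c * z)" if "N dvd x - e * z" for c e x z
  proof -
    have "- (c * x) - e * - (c * z) = - c * (x - e * z)" by (simp add: algebra_simps)
    also have "N dvd \<dots>" by (rule dvd_mult[OF that])
    finally show ?thesis .
  qed
  have **: "N dvd (y - x) - e * (w - z)" if "N dvd y - e * w" "N dvd x - e * z" for e x y z w
  proof -
    have "(y - x) - e * (w - z) = (y - e * w) - (x - e * z)" by (simp add: algebra_simps)
    also have "N dvd \<dots>" by (rule dvd_diff[OF that])
    finally show ?thesis .
  qed
  have de: "d * e = 1" using ed by (simp only: mult.commute)
  show ?thesis unfolding eq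
    by (cases s; simp only: reflect.simps; rule proj_congI[OF de]; (rule dv | rule *[OF dv(3)]
        | rule *[OF dv(1)] | rule **[OF dv(4) dv(3)] | rule **[OF dv(2) dv(1)]))
qed

lemma reflect_reflect:
  assumes "u * v = 1"
  shows "reflect u v s (reflect u v s p) = p"
proof -
  have "u * (v * z) = z" "v * (u * z) = z" for z
    using assms by (metis mult.assoc mult.commute mult_1_left)+
  then show ?thesis by (cases p; cases s) auto
qed

section \<open>Powers of the rotations built from \<open>MA\<close> and \<open>MB\<close>\<close>

lemma act_BA_power:
  "act u v (concat (replicate k [MB, MA])) (x, y, x', y') =
    (u ^ k * x + (\<Sum>i<k. u ^ i) * y, y, v ^ k * x' + (\<Sum>i<k. v ^ i) * y', y')"
proof (induction k)
  case (Suc k)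
  have "(\<Sum>i<Suc k. z ^ i) = z * (\<Sum>i<k. z ^ i) + 1" for z :: 'a
    by (subst sum.lessThan_Suc_shift) (simp add: sum_distrib_left)
  then show ?case by (simp add: Suc algebra_simps del: sum.lessThan_Suc)
qed simp

lemma act_AB_power:
  assumes "u * v = 1"
  shows "act u v (concat (replicate k [MA, MB])) (x, y, x', y') =
    (v ^ k * x - v ^ k * (\<Sum>i<k. u ^ i) * y, y, u ^ k * x' - u ^ k * (\<Sum>i<k. v ^ i) * y', y')"
proof (induction k)
  case (Suc k)
  have "v ^ k * u ^ k = 1" using assms by (simp add: mult.commute[of v] flip: power_mult_distrib)
  then show ?case by (simp add: Suc algebra_simps)
qed simp

text \<open>Both sides equal v + ... + v^k. Thus the sums in \<open>u\<close> and in
  \<open>v\<close> are associates.\<close>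

lemma unit_sum_power:
  assumes "u * v = (1::'a::comm_ring_1)"
  shows "v ^ k * (\<Sum>i<k. u ^ i) = v * (\<Sum>i<k. v ^ i)"
proof (induction k)
  case (Suc k)
  have "v ^ k * u ^ k = 1" using assms by (simp add: mult.commute[of v] flip: power_mult_distrib)
  then have "v ^ Suc k * (\<Sum>i<Suc k. u ^ i) = v * (v ^ k * (\<Sum>i<k. u ^ i)) + v"
    by (simp add: algebra_simps)
  also have "\<dots> = v * (v * (\<Sum>i<k. v ^ i) + 1)" unfolding Suc by (simp add: algebra_simps)
  also have "v * (\<Sum>i<k. v ^ i) + 1 = (\<Sum>i<Suc k. v ^ i)"
    by (subst sum.lessThan_Suc_shift) (simp add: sum_distrib_left)
  finally show ?case .
qed simp

section \<open>The Coxeter relations modulo the q-integer\<close>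

locale triangle_group =
  fixes n :: nat
  assumes n_ge_2: "2 \<le> n"

sublocale triangle_group \<subseteq> coxeter_matrix "order_mat n"
proof
  show "order_mat n s t = order_mat n t s" for s t by (cases s; cases t) auto
  show "s \<noteq> t \<Longrightarrow> 2 \<le> order_mat n s t" for s t using n_ge_2 by (cases s; cases t) auto
qed

context triangle_group
begin

text \<open>Only the pair \<open>MA\<close>, \<open>MB\<close> needs the modulus: \<open>N\<close>
  divides both the off-diagonal sum and \<open>u ^ n - 1\<close>. The other relations hold exactly,
  up to the scalars \<open>- v\<close>, \<open>- u\<close> and \<open>- 1\<close>.\<close>

lemma act_relation:
  assumes uv: "u * v = (1::'a::comm_ring_1)" and N: "N = (\<Sum>i<n. u ^ i)" and "s \<noteq> t"
  shows "proj_cong N (act u v (alt s t (2 * order_mat n s t)) p) p"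
proof -
  obtain x y x' y' where p: "p = (x, y, x', y')" by (cases p rule: prod_cases4)
  define N' where "N' = (\<Sum>i<n. v ^ i)"
  \<comment> \<open>The involution turns \<open>N\<close> into \<open>N'\<close>, which is a unit
    multiple of \<open>N\<close>, so one modulus serves both halves of the quadruple.\<close>
  have "v ^ n * N = v * N'" unfolding N N'_def by (rule unit_sum_power[OF uv])
  moreover have "N' = u * v * N'" by (simp add: uv)
  ultimately have "N' = u * v ^ n * N" by (simp add: mult.assoc)
  then have N': "N dvd N'" by (rule dvdI[OF trans[OF _ mult.commute]])
  have un: "N dvd u ^ n - 1" unfolding N power_diff_1_eq by (rule dvd_triv_right)
  have "N' dvd v ^ n - 1" unfolding N'_def power_diff_1_eq by (rule dvd_triv_right)
  then have vn: "N dvd v ^ n - 1" using N' by (rule dvd_trans[rotated])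
  have plus: "N dvd a * z + b * z' - 1 * z" if "N dvd a - 1" "N dvd b" for a b z z'
  proof -
    have "a * z + b * z' - 1 * z = (a - 1) * z + b * z'" by (simp add: algebra_simps)
    also have "N dvd \<dots>" using that by (intro dvd_add dvd_mult2)
    finally show ?thesis .
  qed
  have minus: "N dvd a * z - c * b * z' - 1 * z" if "N dvd a - 1" "N dvd b" for a b c z z'
    using plus[OF that(1), of "- c * b" z z'] that(2) by simp
  have NN: "N dvd N" by simp
  have vu: "v * u = 1" using uv by (simp only: mult.commute)
  consider "s = MB" "t = MA" | "s = MA" "t = MB" | "s = MA" "t = MC" | "s = MC" "t = MA"
    | "s = MB" "t = MC" | "s = MC" "t = MB"
    using \<open>s \<noteq> t\<close> by (cases s; cases t) auto
  then show ?thesis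
  proof cases
    case 1
    then show ?thesis
      unfolding p 1 order_mat.simps alt_double act_BA_power N[symmetric] N'_def[symmetric]
      by (intro proj_congI[of 1 1] plus un vn N' NN) auto
  next
    case 2
    then show ?thesis
      unfolding p 2 order_mat.simps alt_double act_AB_power[OF uv] N[symmetric] N'_def[symmetric]
      by (intro proj_congI[of 1 1] minus un vn N' NN) auto
  next
    case 3
    have "act u v (alt MA MC (2 * 2)) p = (- v * x, - v * y, - u * x', - u * y')"
      by (simp add: p eval_nat_numeral)
    then show ?thesis unfolding 3 order_mat.simps p
      by (simp only:) (rule proj_congI[of "- v" "- u"], simp_all add: vu)
  next
    case 4
    have "act u v (alt MC MA (2 * 2)) p = (- u * x, - u * y, - v * x', - v * y')"
      by (simp add: p eval_nat_numeral)
    then show ?thesis unfolding 4 order_mat.simps p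
      by (simp only:) (rule proj_congI[of "- u" "- v"], simp_all add: uv)
  next
    case 5
    have "act u v (alt MB MC (2 * 3)) p = (- 1 * x, - 1 * y, - 1 * x', - 1 * y')"
      by (simp add: p eval_nat_numeral)
    then show ?thesis unfolding 5 order_mat.simps p
      by (simp only:) (rule proj_congI[of "- 1" "- 1"], simp_all)
  next
    case 6
    have "act u v (alt MC MB (2 * 3)) p = (- 1 * x, - 1 * y, - 1 * x', - 1 * y')"
      by (simp add: p eval_nat_numeral)
    then show ?thesis unfolding 6 order_mat.simps p
      by (simp only:) (rule proj_congI[of "- 1" "- 1"], simp_all)
  qed
qed

lemma act_word_eq:
  assumes "u * v = (1::'a::comm_ring_1)" and "N = (\<Sum>i<n. u ^ i)" and "word_eq w w'"
  shows "proj_cong N (act u v w p) (act u v w' p)"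
  using assms(3)
proof (induction rule: word_eq.induct)
  case (word_eq_refl w)
  show ?case by (rule proj_cong_refl)
next
  case (word_eq_sym w1 w2)
  show ?case by (rule proj_cong_sym[OF word_eq_sym.IH])
next
  case (word_eq_trans w1 w2 w3)
  show ?case by (rule proj_cong_trans[OF word_eq_trans.IH])
next
  case (word_eq_Cons w1 w2 s)
  then show ?case by (simp add: proj_cong_reflect)
next
  case (word_eq_square s w)
  then show ?case by (simp add: reflect_reflect[OF assms(1)] proj_cong_refl)
next
  case (word_eq_relation s t w)
  then show ?case using act_relation[OF assms(1,2)] by simp
qed

section \<open>The geometric representation at a primitive root of unity\<close>

definition zeta :: complex where
  "zeta = cis (2 * pi / real n)"

lemma zeta_cnj: "zeta * cnj zeta = 1"
  by (simp add: zeta_def cis_cnj cis_mult)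

text \<open>Hermitian forms dual to the simple roots: the reflections of \<open>(x, y)\<close> fire the
  corresponding nodes.\<close>

fun form :: "complex \<Rightarrow> complex \<Rightarrow> mirror \<Rightarrow> real" where
  "form x y MA = 2 * Re (cis (pi / real n) * x * cnj y)"
| "form x y MB = (cmod y)\<^sup>2 - 2 * Re (x * cnj y)"
| "form x y MC = (cmod x)\<^sup>2 - (cmod y)\<^sup>2"

text \<open>The left-hand arguments are the reflected vectors when the primed entries are complex
  conjugates. The phase in the form at \<open>MA\<close> produces the weight 2 cos (pi / n), because
  1 + zeta = 2 cos (pi / n) cis (pi / n).\<close>

lemma form_reflect:
  shows "form (- (cnj zeta * cnj x)) (cnj y) = fire MA (form x y)"
    and "form (cnj y - cnj x) (cnj y) = fire MB (form x y)"
    and "form (cnj y) (cnj x) = fire MC (form x y)"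
proof -
  define c s where "c = cos (pi / real n)" and "s = sin (pi / real n)"
  have cs: "s * s = 1 - c * c"
    unfolding c_def s_def by (simp add: algebra_simps sin_squared_eq flip: power2_eq_square)
  have zeta: "Re zeta = 2 * (c * c) - 1" "Im zeta = 2 * (s * c)"
    using cos_double_cos[of "pi / real n"] sin_double[of "pi / real n"]
    by (simp_all add: zeta_def c_def s_def power2_eq_square)
  have nr: "cmod zeta = 1" by (simp add: zeta_def)
  have weights: "weight MA MA = -2" "weight MB MB = -2" "weight MC MC = -2"
    "weight MA MB = 2 * c" "weight MB MA = 2 * c" "weight MA MC = 0" "weight MC MA = 0"
    "weight MB MC = 1" "weight MC MB = 1"
    by (simp_all add: weight_def c_def cos_60)
  have "c * (2 * (c * c) - 1) + s * (2 * (s * c)) = 2 * c * (c * c + s * s) - c"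
    by (simp add: algebra_simps)
  then have e1: "c * (2 * (c * c) - 1) + s * (2 * (s * c)) = c" unfolding cs by simp
  have e2: "s * (2 * (c * c) - 1) - c * (2 * (s * c)) = - s" by (simp add: algebra_simps)
  \<comment> \<open>\<open>cis (pi / real n)\<close> is a square root of \<open>zeta\<close>; hence
    reflecting in \<open>MA\<close> conjugates and negates the number whose real part defines its
    form.\<close>
  have m: "cis (pi / real n) * cnj zeta = cnj (cis (pi / real n))"
    using e1 e2 by (simp add: complex_eq_iff zeta c_def[symmetric] s_def[symmetric])
  note defs = fire_def weights
  show "form (- (cnj zeta * cnj x)) (cnj y) = fire MA (form x y)"
  proof
    fix r
    show "form (- (cnj zeta * cnj x)) (cnj y) r = fire MA (form x y) r"
    proof (cases r)
      case MA
      have "cis (pi / real n) * (- (cnj zeta * cnj x)) * y = - (cis (pi / real n) * cnj zeta * cnj x * y)"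
        by simp
      also have "\<dots> = - cnj (cis (pi / real n) * x * cnj y)" unfolding m by simp
      finally have "Re (cis (pi / real n) * (- (cnj zeta * cnj x)) * y) = - Re (cis (pi / real n) * x * cnj y)"
        by (metis complex_cnj_cancel_iff cnj.sel(1) uminus_complex.sel(1))
      then show ?thesis unfolding MA defs form.simps by simp
    next
      case MB
      show ?thesis unfolding MB defs form.simps
        by (simp add: zeta c_def[symmetric] s_def[symmetric] algebra_simps)
    qed (simp add: defs norm_mult nr)
  qed
  show "form (cnj y - cnj x) (cnj y) = fire MB (form x y)"
  proof
    show "form (cnj y - cnj x) (cnj y) r = fire MB (form x y) r" for r
      by (cases r; simp add: defs c_def[symmetric] s_def[symmetric] cmod_power2)
        (simp_all add: power2_eq_square algebra_simps)
  qed
  show "form (cnj y) (cnj x) = fire MC (form x y)"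
  proof
    show "form (cnj y) (cnj x) r = fire MC (form x y) r" for r
      by (cases r; simp add: defs cmod_power2) (simp_all add: algebra_simps)
  qed
qed

text \<open>At \<open>u = zeta\<close> and \<open>v = cnj zeta\<close> the orbit stays among
  conjugate pairs, so a word acting on vectors plays the numbers game on their forms.\<close>

lemma act_zeta:
  "\<exists>x y. act zeta (cnj zeta) w (1, 0, 1, 0) = (x, y, cnj x, cnj y) \<and> play w (form 1 0) = form x y"
proof (induction w)
  case Nil
  show ?case by (intro exI[of _ 1] exI[of _ 0]) simp
next
  case (Cons s w)
  then obtain x y where "act zeta (cnj zeta) w (1, 0, 1, 0) = (x, y, cnj x, cnj y)"
    "play w (form 1 0) = form x y" by blast
  then show ?case using form_reflect[where x = x and y = y] by (cases s) auto
qed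

lemma laurent_eval_act:
  assumes "act q q_inv w (1, 0, 1, 0) = (X, Y, X', Y')" and "u * v = 1"
  shows "act u v w (1, 0, 1, 0) =
    (laurent_eval u v X, laurent_eval u v Y, laurent_eval u v X', laurent_eval u v Y')"
  using assms(1)
proof (induction w arbitrary: X Y X' Y')
  case (Cons s w)
  obtain Z W Z' W' where e: "act q q_inv w (1, 0, 1, 0) = (Z, W, Z', W')"
    by (cases "act q q_inv w (1, 0, 1, 0)" rule: prod_cases4)
  then show ?case using Cons.IH[OF e] Cons.prems assms(2) by (cases s) auto
qed (use assms(2) in auto)

text \<open>\<open>MA\<close> and \<open>MB\<close> preserve the line spanned by the first basis
  vector and scale it by units.\<close>

lemma act_stabilizer:
  assumes "u * v = (1::'a::comm_ring_1)" and "MC \<notin> set w"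
  shows "\<exists>e d. e * d = 1 \<and> act u v w (1, 0, 1, 0) = (e, 0, d, 0)"
  using assms(2)
proof (induction w)
  case (Cons s w)
  then obtain e d where ed: "e * d = 1" "act u v w (1, 0, 1, 0) = (e, 0, d, 0)" by auto
  have "(v * d) * (u * e) = (u * v) * (e * d)" by (simp only: ac_simps)
  then have "(v * d) * (u * e) = 1" using ed(1) assms(1) by simp
  moreover have "d * e = 1" using ed(1) by (simp only: mult.commute)
  ultimately show ?case using Cons.prems ed(2) by (cases s) auto
qed simp

text \<open>\<open>form 1 0\<close> is the fundamental weight of \<open>MC\<close>. If
  \<open>Y\<close> vanishes at \<open>zeta\<close>, the word scales this weight by the squared
  modulus of the value of \<open>X\<close>, so it is equivalent to a word without
  \<open>MC\<close>.\<close>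

theorem lower_entry_vanishing:
  assumes act: "act q q_inv w (1, 0, 1, 0) = (X, Y, X', Y')"
    and Y: "laurent_eval zeta (cnj zeta) Y = 0"
  shows "q_int n dvd Y \<and> (\<exists>e d. e * d = 1 \<and> q_int n dvd X - e)"
proof -
  define c where "c = (cmod (laurent_eval zeta (cnj zeta) X))\<^sup>2"
  have base: "form 1 0 r = (if r = MC then 1 else 0)" for r by (cases r) auto
  have play: "play w (form 1 0) = (\<lambda>r. c * form 1 0 r)"
  proof
    fix r
    have "play w (form 1 0) = form (laurent_eval zeta (cnj zeta) X) 0"
      using act_zeta[of w] laurent_eval_act[OF act zeta_cnj] Y by auto
    then show "play w (form 1 0) r = c * form 1 0 r" by (cases r) (auto simp: c_def)
  qed
  \<comment> \<open>The game is invertible and cannot send the nonzero weight to zero.\<close>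
  have "c \<noteq> 0"
  proof
    assume "c = 0"
    then have "form 1 0 = (\<lambda>_. 0)" using play play_eq_0 by fastforce
    then show False using base[of MC] by simp
  qed
  then have "c > 0" by (simp add: c_def)
  moreover have nonneg: "form 1 0 r \<ge> 0" for r by (simp add: base)
  ultimately obtain w' where w': "word_eq w w'" "\<forall>r\<in>set w'. form 1 0 r = 0"
    using stabilizer_parabolic[OF nonneg _ play] by blast
  then have "MC \<notin> set w'" using base by fastforce
  then obtain e d where ed: "e * d = 1" "act q q_inv w' (1, 0, 1, 0) = (e, 0, d, 0)"
    using act_stabilizer[OF q_mult_q_inv(1)] by blast
  \<comment> \<open>Word equivalence is purely formal: found over the complex numbers, it is applied
    here over Laurent polynomials modulo \<open>q_int n\<close>.\<close>
  have "proj_cong (q_int n) (X, Y, X', Y') (e, 0, d, 0)"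
    using act_word_eq[OF q_mult_q_inv(1) q_int_def w'(1), of "(1, 0, 1, 0)"] act ed(2) by simp
  then obtain e' d' where "e' * d' = 1" "q_int n dvd X - e' * e" "q_int n dvd Y" by auto
  moreover from this ed(1) have "(e' * e) * (d' * d) = 1"
    by (simp add: mult.assoc mult.left_commute[of e d'])
  ultimately show ?thesis by blast
qed

end


section \<open>Deformed rationals as orbit points\<close>

lemma ex_word_M_mat: "\<exists>w X' Y'. act q q_inv w (1, 0, 1, 0) = (M_mat cs $$ (0, 0), M_mat cs $$ (1, 0), X', Y')"
proof (induction cs)
  case Nil
  show ?case by (rule exI[of _ "[]"]) simp
next
  case (Cons c cs)
  then obtain w X' Y' where
    w: "act q q_inv w (1, 0, 1, 0) = (M_mat cs $$ (0, 0), M_mat cs $$ (1, 0), X', Y')" by blast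
  show ?case unfolding M_mat_Cons_index
    by (rule exI[of _ "concat (replicate c [MB, MA]) @ [MA, MC] @ w"])
      (simp add: w act_BA_power q_int_def mult.assoc)
qed

text \<open>Stated with reciprocals so that the induction can start at the empty list: there
  \<open>1 / hj_eval []\<close> is 1 / 0 = 0, matching the first column (1, 0) of the
  identity.\<close>

lemma M_mat_eval_1:
  assumes "\<forall>c\<in>set cs. 2 \<le> c"
  defines "ev \<equiv> laurent_eval (1::int) 1"
  shows "ev (M_mat cs $$ (0, 0)) > 0 \<and>
    1 / hj_eval cs = of_int (ev (M_mat cs $$ (1, 0))) / of_int (ev (M_mat cs $$ (0, 0)))"
  using assms(1)
proof (induction cs)
  case Nil
  show ?case by (simp add: ev_def)
next
  case (Cons c cs)
  define a b where "a = ev (M_mat cs $$ (0, 0))" and "b = ev (M_mat cs $$ (1, 0))"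
  have ab: "a > 0" "1 / hj_eval cs = of_int b / of_int a" using Cons by (auto simp: a_def b_def)
  have e: "ev (M_mat (c # cs) $$ (0, 0)) = int c * a - b" "ev (M_mat (c # cs) $$ (1, 0)) = a"
    unfolding M_mat_Cons_index a_def b_def ev_def by (simp_all add: laurent_eval_q_int)
  have hj: "hj_eval (c # cs) = of_int (int c * a - b) / of_int a"
    using ab unfolding hj_eval_Cons ab(2) by (simp add: field_simps)
  moreover have "hj_eval (c # cs) > 1" using Cons.prems by (intro hj_eval_gt_1) auto
  ultimately have "of_int (int c * a - b) / of_int a > (1 :: rat)" by simp
  then have "of_int (int c * a - b) > (0 :: rat)" using ab(1) by (simp add: less_divide_eq)
  then have "int c * a - b > 0" by (simp only: of_int_0_less_iff)
  then show ?case unfolding e hj by simp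
qed

lemma q_fraction_bezout:
  "\<exists>u v s. q_rat x = Fraction_Field.Fract (q_numer x) (q_denom x) \<and>
     u * q_numer x + v * q_denom x = 1 \<and> q_denom x = of_poly s \<and> coeff s 0 = 1"
  using q_rat_bezout[of x] is_q_fraction_of_bezout[of x] is_q_fraction_iff[of x] by metis

text \<open>The reduced fraction is unique, so a Bezout identity for the shifted pair
  suffices.\<close>

lemma q_fraction_add_1:
  shows "q_numer (x + 1) = q * q_numer x + q_denom x" and "q_denom (x + 1) = q_denom x"
proof -
  let ?R = "q_numer x" and ?S = "q_denom x"
  obtain u v s where b: "q_rat x = Fraction_Field.Fract ?R ?S" "u * ?R + v * ?S = 1"
    "?S = of_poly s" "coeff s 0 = 1"
    using q_fraction_bezout by blast
  have "?S \<noteq> 0" using b(3,4) lookup_of_poly[of s 0] by auto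
  then have "q_rat (x + 1) = Fraction_Field.Fract (q * ?R + ?S) ?S"
    unfolding q_rat_add_1 b(1) by (simp add: Fraction_Field.One_fract_def)
  moreover have "(u * q_inv) * (q * ?R + ?S) + (v - u * q_inv) * ?S = 1"
  proof -
    have "(u * q_inv) * (q * ?R + ?S) + (v - u * q_inv) * ?S = (q_inv * q) * (u * ?R) + v * ?S"
      by (simp add: algebra_simps)
    then show ?thesis using b(2) by simp
  qed
  ultimately have "is_q_fraction (x + 1) (q * ?R + ?S) ?S"
    using b(3,4) by (rule is_q_fraction_of_bezout)
  then show "q_numer (x + 1) = q * ?R + ?S" "q_denom (x + 1) = ?S"
    unfolding is_q_fraction_iff by metis+
qed

lemma ex_word_q_fraction: "\<exists>w X' Y'. act q q_inv w (1, 0, 1, 0) = (q_numer x, q_denom x, X', Y')"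
proof (induction x rule: q_rat.induct)
  case (1 x)
  show ?case
  proof (cases "x > 1")
    case True
    then show ?thesis unfolding q_numer_denom_eq_M_mat[OF True] by (intro ex_word_M_mat)
  next
    case False
    then obtain w X' Y' where
      w: "act q q_inv w (1, 0, 1, 0) = (q * q_numer x + q_denom x, q_denom x, X', Y')"
      using "1.IH" unfolding q_fraction_add_1 by blast
    have "q_inv * (q * z) = z" for z by (simp flip: mult.assoc)
    \<comment> \<open>\<open>[MA, MB]\<close> acts as the inverse of the matrix \<open>R_mat\<close>
      and undoes the shift.\<close>
    then show ?thesis by (intro exI[of _ "[MA, MB] @ w"]) (simp add: w)
  qed
qed

lemma q_fraction_eval_1:
  defines "ev \<equiv> laurent_eval (1::int) 1"
  shows "ev (q_denom x) > 0 \<and> x = of_int (ev (q_numer x)) / of_int (ev (q_denom x))"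
proof (induction x rule: q_rat.induct)
  case (1 x)
  show ?case
  proof (cases "x > 1")
    case True
    define cs where "cs = hj_expansion x"
    have hj: "is_hj_expansion x cs" unfolding cs_def using True by (rule is_hj_expansion_hj_expansion)
    then have inv: "1 / x = of_int (ev (q_denom x)) / of_int (ev (q_numer x))" and pos: "ev (q_numer x) > 0"
      using M_mat_eval_1[of cs] unfolding is_hj_expansion_def q_numer_denom_eq_M_mat[OF True] cs_def ev_def
      by auto
    have "1 / x > 0" using True by simp
    then have "ev (q_denom x) > 0" using pos unfolding inv by (simp add: zero_less_divide_iff)
    moreover have "x = 1 / (1 / x)" by simp
    then have "x = of_int (ev (q_numer x)) / of_int (ev (q_denom x))" unfolding inv by simp
    ultimately show ?thesis by blast
  next
    case False
    then show ?thesis using "1.IH" unfolding q_fraction_add_1 by (auto simp: ev_def field_simps)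
  qed
qed

text \<open>The Bezout identity survives at q = 1, so both fractions are in lowest terms with
  positive denominators and therefore agree.\<close>

lemma q_fraction_eval_1_coprime:
  assumes "coprime r s" and "s > 0"
  shows "laurent_eval 1 1 (q_numer (of_int r / of_int s)) = r"
    and "laurent_eval 1 1 (q_denom (of_int r / of_int s)) = s"
proof -
  define x :: rat where "x = of_int r / of_int s"
  define R S :: int where "R = laurent_eval 1 1 (q_numer x)" and "S = laurent_eval 1 1 (q_denom x)"
  have S: "S > 0" and x: "x = of_int R / of_int S" using q_fraction_eval_1[of x] by (auto simp: R_def S_def)
  obtain u v where "u * q_numer x + v * q_denom x = 1" using q_fraction_bezout by blast
  then have "laurent_eval (1::int) 1 (u * q_numer x + v * q_denom x) = 1" by simp
  then have "laurent_eval 1 1 u * R + laurent_eval 1 1 v * S = 1" by (simp add: R_def S_def)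
  then have RS: "coprime R S" by (metis coprimeI dvd_add dvd_mult)
  have "(of_int (r * S) :: rat) = of_int (R * s)"
    using x S assms(2) unfolding x_def by (simp add: field_simps)
  then have eq: "r * S = R * s" by (simp only: of_int_eq_iff)
  have "s dvd S" using eq assms(1) by (metis coprime_commute coprime_dvd_mult_right_iff dvd_triv_right)
  moreover have "S dvd s" using eq RS by (metis coprime_commute coprime_dvd_mult_right_iff dvd_triv_right)
  ultimately have "S = s" using S assms(2) by (intro zdvd_antisym_nonneg) auto
  then show "laurent_eval 1 1 (q_numer (of_int r / of_int s)) = r"
    "laurent_eval 1 1 (q_denom (of_int r / of_int s)) = s"
    using eq assms(2) by (auto simp: R_def S_def x_def)
qed

section \<open>From cyclotomic divisibility to congruences\<close>

context triangle_group
begin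

text \<open>The factor with \<open>k = 1\<close> in the defining product vanishes at
  \<open>zeta\<close>.\<close>

lemma laurent_eval_zeta_cyclotomic: "laurent_eval zeta (cnj zeta) (of_poly (cyclotomic n)) = 0"
proof -
  have n: "n > 0" "1 \<in> totatives n" using n_ge_2 by (auto simp: totatives_def)
  have "poly (complex_cyclotomic n) zeta = 0"
    unfolding complex_cyclotomic_def poly_prod
    by (rule prod_zero[OF finite_totatives bexI[OF _ n(2)]]) (simp add: zeta_def)
  then show ?thesis
    by (simp add: laurent_eval_of_poly[OF zeta_cnj] map_poly_cyclotomic[OF n(1)])
qed

text \<open>At q = 1 the modulus \<open>q_int n\<close> becomes \<open>n\<close>, and a unit becomes
  a unit of the integers, that is 1 or -1.\<close>

lemma cyclotomic_dvd_lower_entry: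
  fixes X Y :: laurent
  defines "ev \<equiv> laurent_eval (1::int) 1"
  assumes "act q q_inv w (1, 0, 1, 0) = (X, Y, X', Y')" and "of_poly (cyclotomic n) dvd Y"
  shows "q_int n dvd Y \<and> [ev Y = 0] (mod int n) \<and> ([ev X = 1] (mod int n) \<or> [ev X = -1] (mod int n))"
proof -
  have "laurent_eval zeta (cnj zeta) Y = 0"
    using laurent_eval_dvd[OF zeta_cnj assms(3)] by (simp add: laurent_eval_zeta_cyclotomic)
  then obtain e d where Y: "q_int n dvd Y" and ed: "e * d = 1" and X: "q_int n dvd X - e"
    using lower_entry_vanishing[OF assms(2)] by blast
  have ev: "ev (q_int n) = int n" by (simp add: ev_def laurent_eval_q_int)
  have "int n dvd ev Y" using laurent_eval_dvd[of "1::int" 1, OF _ Y] ev by (simp add: ev_def)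
  moreover have "int n dvd ev X - ev e"
    using laurent_eval_dvd[of "1::int" 1, OF _ X] ev by (simp add: ev_def)
  moreover have "ev e * ev d = ev (e * d)" by (simp add: ev_def)
  then have "ev e * ev d = 1" by (simp add: ed ev_def)
  then have "ev e = 1 \<or> ev e = -1" by (simp add: zmult_eq_1_iff) blast
  ultimately show ?thesis using Y by (auto simp: cong_iff_dvd_diff)
qed

end

theorem corollary1p3:
  fixes n :: nat and r s :: int
  assumes "n \<ge> 2" and "coprime r s" and "s > 0"
  shows "(of_poly (cyclotomic n) dvd q_denom (of_int r / of_int s) \<longrightarrow>
            q_int n dvd q_denom (of_int r / of_int s) \<and>
            [s = 0] (mod int n) \<and> ([r = 1] (mod int n) \<or> [r = - 1] (mod int n))) \<and>
         (of_poly (cyclotomic n) dvd q_numer (of_int r / of_int s) \<longrightarrow>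
            q_int n dvd q_numer (of_int r / of_int s) \<and>
            [r = 0] (mod int n) \<and> ([s = 1] (mod int n) \<or> [s = - 1] (mod int n)))"
proof -
  interpret triangle_group n using assms(1) by unfold_locales
  let ?R = "q_numer (of_int r / of_int s)" and ?S = "q_denom (of_int r / of_int s)"
  note ev = q_fraction_eval_1_coprime[OF assms(2,3)]
  obtain w X' Y' where w: "act q q_inv w (1, 0, 1, 0) = (?R, ?S, X', Y')"
    using ex_word_q_fraction by blast
  \<comment> \<open>\<open>[MA, MC]\<close> acts as \<open>S_mat\<close> and moves the numerator to
    the lower entry. The new upper entry becomes \<open>- s\<close> at q = 1; its sign is absorbed
    by the two alternatives.\<close>
  have w': "act q q_inv ([MA, MC] @ w) (1, 0, 1, 0) = (- (q_inv * ?S), ?R, - (q * Y'), X')"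
    by (simp add: w)
  have neg: "[- s = 1] (mod int n) \<longleftrightarrow> [s = - 1] (mod int n)" "[- s = - 1] (mod int n) \<longleftrightarrow> [s = 1] (mod int n)"
    using cong_minus_minus_iff[of s "- 1" "int n"] cong_minus_minus_iff[of s 1 "int n"] by simp_all
  show ?thesis
    using cyclotomic_dvd_lower_entry[OF w] cyclotomic_dvd_lower_entry[OF w'] neg
    by (auto simp: ev)
qed

end
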